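(* Let $n$ be a positive integer and let the edges of the complete graph $K_n$ be properly coloured (with any number of colours). Then for every integer $t$ with $0.0007n\leq t\leq 0.2n$, the coloured $K_n$ contains $\lfloor 10^{-6}n\rfloor$ pairwise edge-disjoint rainbow spanning $t$-spiders.
   Context: An edge-colouring is proper if no two edges sharing a vertex have the same colour. A subgraph is rainbow if all its edges have different colours. A subgraph is spanning if it contains all vertices of the host graph. For an integer $t\ge 0$, a graph $S$ is a $t$-spider if its vertices can be labelled as distinct vertices $V(S)=\{r,j_1,\dots,j_t,x_1,\dots,x_t,y_1,\dots,y_{|S|-2t-1}\}$ (where $|S|=|V(S)|\ge 2t+1$) with $E(S)=\{rj_1,\dots,rj_t\}\cup\{ry_1,\dots,ry_{|S|-2t-1}\}\cup\{j_1x_1,\dots,j_tx_t\}$; that is, $S$ is obtained from a star by subdividing $t$ of its edges once. *)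

theory Defs
  imports Complex_Main "HOL-Library.Ramsey" "HOL-Library.Disjoint_Sets"
begin

text \<open>A graph is a pair of a vertex set and a set of edges, an edge being a two-element set of
  vertices. The set \<open>nsets V 2\<close> is the library's set of all two-element subsets of \<open>V\<close>.\<close>

type_synonym 'a graph = "'a set \<times> 'a set set"

abbreviation vertices :: "'a graph \<Rightarrow> 'a set" where
  "vertices G \<equiv> fst G"

abbreviation edges :: "'a graph \<Rightarrow> 'a set set" where
  "edges G \<equiv> snd G"

definition is_graph :: "'a graph \<Rightarrow> bool" where
  "is_graph G \<longleftrightarrow> finite (vertices G) \<and> edges G \<subseteq> nsets (vertices G) 2"

definition complete_graph :: "'a set \<Rightarrow> 'a graph" where
  "complete_graph V = (V, nsets V 2)"

definition subgraph :: "'a graph \<Rightarrow> 'a graph \<Rightarrow> bool" where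
  "subgraph H G \<longleftrightarrow> is_graph H \<and> vertices H \<subseteq> vertices G \<and> edges H \<subseteq> edges G"

definition spanning_subgraph :: "'a graph \<Rightarrow> 'a graph \<Rightarrow> bool" where
  "spanning_subgraph H G \<longleftrightarrow> subgraph H G \<and> vertices H = vertices G"

text \<open>An edge-colouring is a function on sets of vertices; only its values on edges matter.\<close>

definition proper_edge_colouring :: "'a graph \<Rightarrow> ('a set \<Rightarrow> 'c) \<Rightarrow> bool" where
  "proper_edge_colouring G c \<longleftrightarrow>
     (\<forall>e\<in>edges G. \<forall>f\<in>edges G. e \<noteq> f \<and> e \<inter> f \<noteq> {} \<longrightarrow> c e \<noteq> c f)"

definition rainbow :: "('a set \<Rightarrow> 'c) \<Rightarrow> 'a graph \<Rightarrow> bool" where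
  "rainbow c H \<longleftrightarrow> inj_on c (edges H)"

text \<open>The vertices \<open>r\<close>, \<open>j\<^sub>1, \<dots>, j\<^sub>t\<close>, \<open>x\<^sub>1, \<dots>, x\<^sub>t\<close> and \<open>y\<^sub>1, y\<^sub>2, \<dots>\<close> are listed by
  \<open>r\<close>, \<open>js\<close>, \<open>xs\<close> and \<open>ys\<close>. As they are distinct and exhaust the vertex set, there are
  \<open>2 * t + 1 + length ys\<close> vertices; in particular there are at least \<open>2 * t + 1\<close>.\<close>

definition spider :: "nat \<Rightarrow> 'a graph \<Rightarrow> bool" where
  "spider t S \<longleftrightarrow>
     (\<exists>r js xs ys.
        length js = t \<and> length xs = t \<and>
        distinct (r # js @ xs @ ys) \<and>
        vertices S = set (r # js @ xs @ ys) \<and>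
        edges S = {{r, j} | j. j \<in> set js} \<union> {{r, y} | y. y \<in> set ys}
                  \<union> {{js ! i, xs ! i} | i. i < t})"

end

(* Fix a root r and a proper colouring. A star at r is rainbow, and a rainbow spider rooted at r is
   obtained by choosing a set X of t vertices to be detached from r and re-attaching x in X to g x,
   where the edges x--g x have distinct colours, each of which either does not occur at r or was freed,
   i.e. is the colour of an edge from r to X. If x is pending (detached but not yet re-attached), then
   re-attaching it by an edge whose colour is that of r--y forces y into X as the next pending vertex.
   Since t <= n/5, such a chain x1, x2, ... can be continued greedily up to length t - 2. To close it, a
   small set of vertices and colours is put aside at the beginning: vertices y in Y with an edge y--h y
   whose colour is that of r--x1 or absent at r, and a set R meeting the useful neighbourhood of every x,
   so that the last pending vertex p has an edge p--j to R with the colour of r--y for some y in Y.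

   For edge-disjointness, the roots r_0, r_1, ... are processed in turn. In the spider of r_k all r_i with
   i < k are detached from r_k and re-attached to vertices which were detached from r_i. If the colour of
   r_k--r_i is too rare to be used again, then an edge whose colour is absent at r_k is used instead.
   Such edges are reserved in advance; a weighted sparse subset argument provides roots few of whose
   mutual edges have rare colours, so that there is room for the reservation. *)
theory Submission
  imports Defs
begin

section \<open>Hitting sets and sparse subsets\<close>

text \<open>The scale \<open>b\<close> is about n/1000, and the number \<open>m\<close> of spiders
  is at most b/1000, so that a small multiple of \<open>m\<close> vertices or colours is negligible
  against \<open>b\<close>. The case distinction behind the proof is between vertices that see many
  colours absent at r (\<open>rich\<close>) and vertices whose colours are nearly those of r. If
  many vertices are rich, a pending vertex can be disposed of through absent colours. If few are, a
  freed colour is passed on directly, which works only if it occurs at many vertices; hence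
  \<open>popular\<close>. The obstacle is the edge between two roots: it lies in the star of the
  earlier one, so the later root has to give it up, however rare its colour is. The bound n/5 comes
  from the chain: with X detached, the next neighbour has to avoid X, g X, the colours used on X and
  the colours from r to g X. These are at most 4 |X| choices, and the remaining fifth of the
  vertices pays for the reserve that closes the chain.\<close>

text \<open>Greedy choice with the weights \<open>\<beta> ^ card (A i \<inter> S)\<close>: by
  averaging, some new element lies in sets carrying at least an \<alpha>-fraction of the total
  weight, and adding it lowers the total by the factor 1 - \<alpha> (1 - \<beta>). With \<beta> = 0
  the sum counts the sets not hit yet, and a set already hit has weight 0, so it may become small.
  With 0 < \<beta> < 1 a small sum forces every set to be hit many times.\<close>

lemma multi_hit:
  fixes A :: "'i \<Rightarrow> 'a set" and \<alpha> \<beta> :: real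
  assumes U: "finite U" "U \<noteq> {}" and I: "finite I" and \<beta>: "0 \<le> \<beta>" "\<beta> \<le> 1" and \<alpha>: "0 \<le> \<alpha>" "\<alpha> \<le> 1"
    and sub: "\<And>i. i \<in> I \<Longrightarrow> A i \<subseteq> U"
    and big: "\<And>i S. i \<in> I \<Longrightarrow> S \<subseteq> U \<Longrightarrow> card S < N \<Longrightarrow>
                (\<beta> = 0 \<and> A i \<inter> S \<noteq> {}) \<or> \<alpha> * card U \<le> card (A i - S)"
  shows "\<exists>S\<subseteq>U. card S \<le> N \<and> (\<Sum>i\<in>I. \<beta> ^ card (A i \<inter> S)) \<le> card I * (1 - \<alpha> * (1 - \<beta>)) ^ N"
proof -
  have "k \<le> N \<Longrightarrow> \<exists>S\<subseteq>U. card S \<le> k \<and> (\<Sum>i\<in>I. \<beta> ^ card (A i \<inter> S)) \<le> card I * (1 - \<alpha> * (1 - \<beta>)) ^ k" for k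
  proof (induction k)
    case 0
    show ?case by (intro exI[of _ "{}"]) simp
  next
    case (Suc k)
    then obtain S where S: "S \<subseteq> U" "card S \<le> k"
      and le: "(\<Sum>i\<in>I. \<beta> ^ card (A i \<inter> S)) \<le> card I * (1 - \<alpha> * (1 - \<beta>)) ^ k" by auto
    define w where "w i = \<beta> ^ card (A i \<inter> S)" for i
    have finS: "finite S" using S U finite_subset by blast
    have w0: "0 \<le> w i" for i using \<beta> by (simp add: w_def)
    define h where "h v = (\<Sum>i\<in>I. if v \<in> A i - S then w i else 0)" for v
    have "(\<Sum>v\<in>U. h v) = (\<Sum>i\<in>I. \<Sum>v\<in>U. if v \<in> A i - S then w i else 0)"
      unfolding h_def by (rule sum.swap)
    also have "\<dots> = (\<Sum>i\<in>I. w i * card (A i - S))"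
    proof (rule sum.cong[OF refl])
      fix i assume "i \<in> I"
      then have "U \<inter> (A i - S) = A i - S" using sub by blast
      then have "(\<Sum>v\<in>U. if v \<in> A i - S then w i else 0) = (\<Sum>v\<in>A i - S. w i)"
        using sum.inter_restrict[OF U(1), of "\<lambda>_. w i" "A i - S"] by simp
      then show "(\<Sum>v\<in>U. if v \<in> A i - S then w i else 0) = w i * card (A i - S)" by simp
    qed
    also have "\<dots> \<ge> (\<Sum>i\<in>I. w i * (\<alpha> * card U))"
    proof (rule sum_mono)
      fix i assume i: "i \<in> I"
      from big[OF i S(1)] S(2) Suc.prems
      consider "\<beta> = 0" "A i \<inter> S \<noteq> {}" | "\<alpha> * card U \<le> card (A i - S)" by fastforce
      then show "w i * (\<alpha> * card U) \<le> w i * card (A i - S)"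
      proof cases
        case 1
        then have "w i = 0" using finS by (simp add: w_def card_gt_0_iff)
        then show ?thesis by simp
      next
        case 2 then show ?thesis using w0 by (simp add: mult_left_mono)
      qed
    qed
    finally have avg: "(\<Sum>v\<in>U. \<alpha> * (\<Sum>i\<in>I. w i)) \<le> (\<Sum>v\<in>U. h v)"
      by (simp add: sum_distrib_left sum_distrib_right mult_ac)
    have "\<exists>v\<in>U. \<alpha> * (\<Sum>i\<in>I. w i) \<le> h v"
    proof (rule ccontr)
      assume "\<not> ?thesis"
      then have "(\<Sum>v\<in>U. h v) < (\<Sum>v\<in>U. \<alpha> * (\<Sum>i\<in>I. w i))"
        using U by (intro sum_strict_mono) auto
      with avg show False by simp
    qed
    then obtain v where v: "v \<in> U" "\<alpha> * (\<Sum>i\<in>I. w i) \<le> h v" by blast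
    have new: "\<beta> ^ card (A i \<inter> insert v S) = w i - (1 - \<beta>) * (if v \<in> A i - S then w i else 0)" for i
    proof (cases "v \<in> A i - S")
      case True
      then have "A i \<inter> insert v S = insert v (A i \<inter> S)" "v \<notin> A i \<inter> S" by auto
      then have "card (A i \<inter> insert v S) = Suc (card (A i \<inter> S))" using finS by simp
      then show ?thesis using True by (simp add: w_def algebra_simps)
    next
      case False
      then have "A i \<inter> insert v S = A i \<inter> S" by auto
      then show ?thesis by (simp only: w_def if_not_P[OF False] mult_zero_right diff_zero)
    qed
    have "(\<Sum>i\<in>I. \<beta> ^ card (A i \<inter> insert v S)) = (\<Sum>i\<in>I. w i) - (1 - \<beta>) * h v"
      unfolding new h_def by (simp add: sum_subtractf sum_distrib_left)
    also have "\<dots> \<le> (\<Sum>i\<in>I. w i) - (1 - \<beta>) * (\<alpha> * (\<Sum>i\<in>I. w i))"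
      using v(2) \<beta> by (simp add: mult_left_mono)
    also have "\<dots> = (1 - \<alpha> * (1 - \<beta>)) * (\<Sum>i\<in>I. w i)" by (simp add: algebra_simps)
    also have "\<dots> \<le> (1 - \<alpha> * (1 - \<beta>)) * (card I * (1 - \<alpha> * (1 - \<beta>)) ^ k)"
      using le \<alpha> \<beta> by (intro mult_left_mono) (auto simp: w_def mult_le_one)
    finally have "(\<Sum>i\<in>I. \<beta> ^ card (A i \<inter> insert v S)) \<le> card I * (1 - \<alpha> * (1 - \<beta>)) ^ Suc k"
      by (simp add: mult_ac)
    moreover have "card (insert v S) \<le> Suc k" using S finS by (simp add: card_insert_if)
    ultimately show ?case using v S by (intro exI[of _ "insert v S"]) auto
  qed
  then show ?thesis by blast
qed

section \<open>Sparse subsets of a weighted digraph\<close>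

text \<open>A random partition into \<open>N\<close> classes keeps a pair together with probability
  1/N. Without randomness: each new vertex joins a class in which its weight, in both directions, is
  at most the average over the classes.\<close>

lemma sparse_partition:
  fixes w :: "'a \<Rightarrow> 'a \<Rightarrow> real" and N :: nat
  assumes "finite V" "N > 0"
  shows "\<exists>f :: 'a \<Rightarrow> nat. (\<forall>v. f v < N) \<and>
     N * (\<Sum>u\<in>V. \<Sum>v\<in>V. if u \<noteq> v \<and> f u = f v then w u v else 0) \<le> (\<Sum>u\<in>V. \<Sum>v\<in>V. if u \<noteq> v then w u v else 0)"
  using assms(1)
proof (induction V)
  case empty
  show ?case by (rule exI[of _ "\<lambda>_. 0"]) (simp add: assms(2))
next
  case (insert a V)
  from insert.IH obtain f :: "'a \<Rightarrow> nat" where f: "\<forall>v. f v < N" and le: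
    "N * (\<Sum>u\<in>V. \<Sum>v\<in>V. if u \<noteq> v \<and> f u = f v then w u v else 0) \<le> (\<Sum>u\<in>V. \<Sum>v\<in>V. if u \<noteq> v then w u v else 0)"
    by (elim exE conjE) (rule that)
  define s where "s i = (\<Sum>v\<in>V. if f v = i then w a v + w v a else 0)" for i
  have tot: "(\<Sum>i<N. s i) = (\<Sum>v\<in>V. w a v + w v a)"
  proof -
    have "(\<Sum>i<N. s i) = (\<Sum>v\<in>V. \<Sum>i<N. if f v = i then w a v + w v a else 0)"
      unfolding s_def by (rule sum.swap)
    also have "\<dots> = (\<Sum>v\<in>V. w a v + w v a)"
      using f by (intro sum.cong) auto
    finally show ?thesis .
  qed
  have "\<exists>i<N. N * s i \<le> (\<Sum>v\<in>V. w a v + w v a)"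
  proof (rule ccontr)
    assume "\<not> ?thesis"
    then have "(\<Sum>i<N. (\<Sum>v\<in>V. w a v + w v a)) < (\<Sum>i<N. N * s i)"
      using assms(2) by (intro sum_strict_mono) auto
    then show False using tot by (simp flip: sum_distrib_left)
  qed
  then obtain i where i: "i < N" "N * s i \<le> (\<Sum>v\<in>V. w a v + w v a)" by blast
  define g where "g = f(a := i)"
  have ga: "g a = i" and gv: "\<And>v. v \<in> V \<Longrightarrow> g v = f v" using insert.hyps by (auto simp: g_def)
  have ne: "\<And>v. v \<in> V \<Longrightarrow> v \<noteq> a" using insert.hyps by auto
  have split: "(\<Sum>u\<in>insert a V. \<Sum>v\<in>insert a V. k u v) =
      k a a + (\<Sum>v\<in>V. k a v + k v a) + (\<Sum>u\<in>V. \<Sum>v\<in>V. k u v)" for k :: "'a \<Rightarrow> 'a \<Rightarrow> real"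
    using insert.hyps by (simp add: sum.distrib)
  have A: "(\<Sum>u\<in>insert a V. \<Sum>v\<in>insert a V. if u \<noteq> v \<and> g u = g v then w u v else 0)
      = s i + (\<Sum>u\<in>V. \<Sum>v\<in>V. if u \<noteq> v \<and> f u = f v then w u v else 0)"
  proof -
    have "(\<Sum>v\<in>V. (if a \<noteq> v \<and> g a = g v then w a v else 0) + (if v \<noteq> a \<and> g v = g a then w v a else 0)) = s i"
      unfolding s_def by (intro sum.cong refl) (use ne ga gv in auto)
    moreover have "(\<Sum>u\<in>V. \<Sum>v\<in>V. if u \<noteq> v \<and> g u = g v then w u v else 0) =
        (\<Sum>u\<in>V. \<Sum>v\<in>V. if u \<noteq> v \<and> f u = f v then w u v else 0)"
      by (intro sum.cong refl) (use gv in auto)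
    ultimately show ?thesis by (subst split) simp
  qed
  have B: "(\<Sum>u\<in>insert a V. \<Sum>v\<in>insert a V. if u \<noteq> v then w u v else 0)
      = (\<Sum>v\<in>V. w a v + w v a) + (\<Sum>u\<in>V. \<Sum>v\<in>V. if u \<noteq> v then w u v else 0)"
  proof -
    have "(\<Sum>v\<in>V. (if a \<noteq> v then w a v else 0) + (if v \<noteq> a then w v a else 0)) = (\<Sum>v\<in>V. w a v + w v a)"
      by (intro sum.cong refl) (use ne in auto)
    then show ?thesis by (subst split) simp
  qed
  have "\<forall>v. g v < N" using f i by (simp add: g_def)
  moreover have "N * (\<Sum>u\<in>insert a V. \<Sum>v\<in>insert a V. if u \<noteq> v \<and> g u = g v then w u v else 0)
     \<le> (\<Sum>u\<in>insert a V. \<Sum>v\<in>insert a V. if u \<noteq> v then w u v else 0)"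
    unfolding A B distrib_left using i(2) le by linarith
  ultimately show ?case by blast
qed

text \<open>With 32 classes the average weight of a vertex inside its class is at most 16/32, so by
  Markov's inequality at least half of the vertices have inner weight at most 1. Some class contains
  at least 1/32 of these, which accounts for the 64.\<close>

lemma sparse_subset:
  fixes w :: "'a \<Rightarrow> 'a \<Rightarrow> real"
  assumes V: "finite V" and pos: "\<And>u v. 0 \<le> w u v"
    and row: "\<And>u. u \<in> V \<Longrightarrow> (\<Sum>v\<in>V. w u v) \<le> 16" and M: "64 * M \<le> card V" and w0: "\<And>u. w u u = 0"
  shows "\<exists>T\<subseteq>V. card T = M \<and> (\<forall>u\<in>T. (\<Sum>v\<in>T. w u v) \<le> 1)"
proof -
  obtain f :: "'a \<Rightarrow> nat" where f: "\<And>v. f v < 32" and le: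
    "32 * (\<Sum>u\<in>V. \<Sum>v\<in>V. if u \<noteq> v \<and> f u = f v then w u v else 0) \<le> (\<Sum>u\<in>V. \<Sum>v\<in>V. if u \<noteq> v then w u v else 0)"
    using sparse_partition[OF V, of 32 w] by auto
  define d where "d u = (\<Sum>v\<in>V. if f u = f v then w u v else 0)" for u
  have d0: "0 \<le> d u" for u unfolding d_def by (intro sum_nonneg) (simp add: pos)
  have "32 * (\<Sum>u\<in>V. d u) \<le> (\<Sum>u\<in>V. \<Sum>v\<in>V. w u v)"
  proof -
    have "d u = (\<Sum>v\<in>V. if u \<noteq> v \<and> f u = f v then w u v else 0)" for u
      unfolding d_def by (intro sum.cong) (auto simp: w0)
    moreover have "(\<Sum>u\<in>V. \<Sum>v\<in>V. if u \<noteq> v then w u v else 0) = (\<Sum>u\<in>V. \<Sum>v\<in>V. w u v)"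
      by (intro sum.cong) (auto simp: w0)
    ultimately show ?thesis using le by simp
  qed
  also have "\<dots> \<le> (\<Sum>u\<in>V. 16)" by (intro sum_mono row)
  finally have tot: "2 * (\<Sum>u\<in>V. d u) \<le> card V" by simp
  define G where "G = {u \<in> V. d u \<le> 1}"
  have "real (card (V - G)) = (\<Sum>u\<in>V - G. 1)" by simp
  also have "\<dots> \<le> (\<Sum>u\<in>V - G. d u)" by (intro sum_mono) (auto simp: G_def)
  also have "\<dots> \<le> (\<Sum>u\<in>V. d u)" using V d0 by (intro sum_mono2) auto
  finally have "2 * card (V - G) \<le> card V" using tot by linarith
  moreover have "card (V - G) = card V - card G" "card G \<le> card V"
    using V by (auto simp: G_def card_Diff_subset card_mono)
  ultimately have G: "card V \<le> 2 * card G" by linarith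
  have "\<exists>i<32. M \<le> card {u \<in> G. f u = i}"
  proof (rule ccontr)
    assume neg: "\<not> ?thesis"
    then have "M > 0" by (metis bot_nat_0.extremum gr_zeroI zero_less_numeral)
    have "G = (\<Union>i<32. {u \<in> G. f u = i})" using f by auto
    then have "card G \<le> (\<Sum>i<32. card {u \<in> G. f u = i})"
      by (metis card_UN_le finite_lessThan)
    also have "\<dots> \<le> (\<Sum>i<(32::nat). M - 1)" using neg by (intro sum_mono) (force simp: not_le)
    finally show False using G M \<open>M > 0\<close> by simp
  qed
  then obtain i where "M \<le> card {u \<in> G. f u = i}" by blast
  then obtain T where T: "T \<subseteq> {u \<in> G. f u = i}" "card T = M" by (meson obtain_subset_with_card_n)
  have "(\<Sum>v\<in>T. w u v) \<le> 1" if "u \<in> T" for u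
  proof -
    have "(\<Sum>v\<in>T. w u v) = (\<Sum>v\<in>T. if f u = f v then w u v else 0)"
      using T that by (intro sum.cong) auto
    also have "\<dots> \<le> d u" unfolding d_def
      using T V by (intro sum_mono2) (auto simp: G_def pos)
    also have "\<dots> \<le> 1" using T that by (auto simp: G_def)
    finally show ?thesis .
  qed
  then show ?thesis using T by (intro exI[of _ T]) (auto simp: G_def)
qed

section \<open>Proper colourings of a clique\<close>

lemma card_filter_split: "finite S \<Longrightarrow> card S = card {x \<in> S. P x} + card {x \<in> S. \<not> P x}"
  by (subst card_Un_disjoint[symmetric]) (auto intro: arg_cong[where f = card])

locale coloured_clique =
  fixes V :: "'a set" and col :: "'a \<Rightarrow> 'a \<Rightarrow> 'c"
  assumes finV: "finite V"
    and col_sym: "col u v = col v u"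
    and proper: "u \<in> V \<Longrightarrow> v \<in> V \<Longrightarrow> w \<in> V \<Longrightarrow> v \<noteq> u \<Longrightarrow> w \<noteq> u \<Longrightarrow> v \<noteq> w \<Longrightarrow> col u v \<noteq> col u w"
begin

lemma col_eqD: "u \<in> V \<Longrightarrow> v \<in> V \<Longrightarrow> w \<in> V \<Longrightarrow> v \<noteq> u \<Longrightarrow> w \<noteq> u \<Longrightarrow> col u v = col u w \<Longrightarrow> v = w"
  using proper by blast

lemma inj_col: "u \<in> V \<Longrightarrow> inj_on (col u) (V - {u})"
  by (rule inj_onI) (use col_eqD in auto)

definition star_cols :: "'a \<Rightarrow> 'c set" where
  "star_cols r = col r ` (V - {r})"

definition outside :: "'a \<Rightarrow> 'a \<Rightarrow> 'a set" where
  "outside r z = {v \<in> V - {z}. col z v \<notin> star_cols r}"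

definition has_col :: "'a \<Rightarrow> 'c \<Rightarrow> bool" where
  "has_col z q \<longleftrightarrow> q \<in> star_cols z"

lemma finite_outside [simp]: "finite (outside r z)"
  using finV by (simp add: outside_def)

lemma outside_subset: "outside r z \<subseteq> V - {z}"
  by (auto simp: outside_def)

lemma card_col_le:
  assumes "z \<in> V" "finite K"
  shows "card {v \<in> V - {z}. col z v \<in> K} \<le> card K"
  using assms inj_col[OF assms(1)]
  by (intro card_inj_on_le[of "col z"]) (auto simp: inj_on_def)

text \<open>Both sides count the colours on edges from \<open>r\<close> to \<open>G\<close> that
  occur at \<open>y\<close>; a colour determines its edge at \<open>r\<close> and its edge at
  \<open>y\<close>.\<close>

lemma card_link:
  assumes r: "r \<in> V" and y: "y \<in> V" and G: "G \<subseteq> V - {r}"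
  shows "card {j \<in> V - {y}. col y j \<in> col r ` G} = card {z \<in> G. has_col y (col r z)}"
proof -
  have "col y ` {j \<in> V - {y}. col y j \<in> col r ` G} = col r ` {z \<in> G. has_col y (col r z)}"
    unfolding has_col_def star_cols_def by (auto simp: image_iff) (metis Diff_iff singletonD)+
  moreover have "inj_on (col y) {j \<in> V - {y}. col y j \<in> col r ` G}"
    using inj_col[OF y] by (rule inj_on_subset) auto
  moreover have "inj_on (col r) {z \<in> G. has_col y (col r z)}"
    using inj_col[OF r] by (rule inj_on_subset) (use G in auto)
  ultimately show ?thesis using card_image[of "col y" "{j \<in> V - {y}. col y j \<in> col r ` G}"]
      card_image[of "col r" "{z \<in> G. has_col y (col r z)}"] by simp
qed

text \<open>The stars of \<open>r\<close> and \<open>z\<close> have equally many colours, so as many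
  colours occur only at \<open>z\<close> as only at \<open>r\<close>. This turns sums over
  \<open>outside\<close> into counts of the vertices that miss a given colour of
  \<open>r\<close>.\<close>

lemma card_outside:
  assumes r: "r \<in> V" and z: "z \<in> V"
  shows "card (outside r z) = card {u \<in> V - {r}. \<not> has_col z (col r u)}"
proof -
  have "card (V - {z}) = card {j \<in> V - {z}. col z j \<in> col r ` (V - {r})} + card (outside r z)"
    using card_filter_split[of "V - {z}" "\<lambda>j. col z j \<in> col r ` (V - {r})"] finV
    by (simp add: outside_def star_cols_def)
  moreover have "card (V - {r}) = card {u \<in> V - {r}. has_col z (col r u)} + card {u \<in> V - {r}. \<not> has_col z (col r u)}"
    using card_filter_split[of "V - {r}" "\<lambda>u. has_col z (col r u)"] finV by simp
  moreover have "card (V - {z}) = card (V - {r})" using r z finV by simp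
  ultimately show ?thesis using card_link[OF r z, of "V - {r}"] by simp
qed

text \<open>Only the colours of \<open>r\<close> missing at \<open>y\<close> are lost, and
  \<open>card_outside\<close> counts them.\<close>

lemma card_link_ge:
  assumes r: "r \<in> V" and y: "y \<in> V" and G: "G \<subseteq> V - {r}"
  shows "card G \<le> card {j \<in> V - {y}. col y j \<in> col r ` G} + card (outside r y)"
proof -
  have fG: "finite G" using G finV finite_subset by blast
  have "card G = card {z \<in> G. has_col y (col r z)} + card {z \<in> G. \<not> has_col y (col r z)}"
    using card_filter_split[OF fG] .
  moreover have "card {z \<in> G. \<not> has_col y (col r z)} \<le> card (outside r y)"
    unfolding card_outside[OF r y] using G finV by (intro card_mono) auto
  ultimately show ?thesis using card_link[OF assms] by simp
qed

text \<open>If \<open>y\<close> is re-attached to \<open>j\<close> with the colour of the edge from \<open>r\<close> to \<open>z\<close>, then \<open>z\<close> cannot be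
  re-attached with the colour \<open>q\<close> when the edge in question leads to \<open>j\<close> as well.\<close>

definition coincidences :: "'a \<Rightarrow> 'c \<Rightarrow> 'a \<Rightarrow> 'a set" where
  "coincidences r q y = {z \<in> V - {r}. \<exists>j\<in>V - {y} - {z}. col y j = col r z \<and> col z j = q}"

text \<open>A vertex z is a coincidence for at most one y: \<open>q\<close> determines j as the
  neighbour of z in that colour, and then the colour of r--z determines y as a neighbour of j. The
  bound follows by double counting.\<close>

lemma card_many_coincidences:
  "card {y \<in> V. k \<le> card (coincidences r q y)} * k \<le> card V"
proof -
  have one: "card {y \<in> V. z \<in> coincidences r q y} \<le> 1" if z: "z \<in> V" for z
  proof -
    have "y = y'" if "y \<in> V" "y' \<in> V" "z \<in> coincidences r q y" "z \<in> coincidences r q y'" for y y'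
    proof -
      obtain j where j: "j \<in> V" "j \<noteq> y" "j \<noteq> z" "col y j = col r z" "col z j = q"
        using \<open>z \<in> coincidences r q y\<close> by (auto simp: coincidences_def)
      obtain j' where j': "j' \<in> V" "j' \<noteq> y'" "j' \<noteq> z" "col y' j' = col r z" "col z j' = q"
        using \<open>z \<in> coincidences r q y'\<close> by (auto simp: coincidences_def)
      have "j = j'" using col_eqD[OF z j(1) j'(1)] j j' by auto
      then show ?thesis using col_eqD[of j y y'] j j' that col_sym[of j y] col_sym[of j y'] by simp
    qed
    then show ?thesis by (auto simp: card_le_Suc0_iff_eq finV)
  qed
  have "card {y \<in> V. k \<le> card (coincidences r q y)} * k = (\<Sum>y\<in>{y \<in> V. k \<le> card (coincidences r q y)}. k)" by simp
  also have "\<dots> \<le> (\<Sum>y\<in>{y \<in> V. k \<le> card (coincidences r q y)}. card (coincidences r q y))" by (intro sum_mono) auto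
  also have "\<dots> \<le> (\<Sum>y\<in>V. card (coincidences r q y))" using finV by (intro sum_mono2) auto
  also have "\<dots> = (\<Sum>y\<in>V. \<Sum>z\<in>V. if z \<in> coincidences r q y then 1 else 0)"
  proof (rule sum.cong[OF refl])
    fix y
    have "V \<inter> coincidences r q y = coincidences r q y" by (auto simp: coincidences_def)
    then show "card (coincidences r q y) = (\<Sum>z\<in>V. if z \<in> coincidences r q y then 1 else 0)"
      using sum.inter_restrict[OF finV, of "\<lambda>_. 1::nat" "coincidences r q y"] by simp
  qed
  also have "\<dots> = (\<Sum>z\<in>V. \<Sum>y\<in>V. if z \<in> coincidences r q y then 1 else 0)" by (rule sum.swap)
  also have "\<dots> = (\<Sum>z\<in>V. card {y \<in> V. z \<in> coincidences r q y})"
    using finV by (intro sum.cong) (auto simp: sum.If_cases Int_def)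
  also have "\<dots> \<le> (\<Sum>z\<in>V. 1)" using one by (intro sum_mono)
  finally show ?thesis by simp
qed

text \<open>A vertex of \<open>B\<close> has at most one neighbour in the colour
  \<open>q\<close>.\<close>

lemma card_col_nbr_le:
  assumes "finite B" "B \<subseteq> V"
  shows "card {z \<in> V. \<exists>k\<in>B. k \<noteq> z \<and> col z k = q} \<le> card B"
proof -
  let ?S = "{z \<in> V. \<exists>k\<in>B. k \<noteq> z \<and> col z k = q}"
  define h where "h z = (SOME k. k \<in> B \<and> k \<noteq> z \<and> col z k = q)" for z
  have h: "h z \<in> B \<and> h z \<noteq> z \<and> col z (h z) = q" if "z \<in> ?S" for z
    unfolding h_def by (rule someI_ex) (use that in blast)
  have "inj_on h ?S"
  proof (rule inj_onI)
    fix z z' assume z: "z \<in> ?S" "z' \<in> ?S" "h z = h z'"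
    have "h z \<in> V" "z \<in> V" "z' \<in> V" using h[OF z(1)] z assms by auto
    moreover have "col (h z) z = col (h z) z'"
      using h[OF z(1)] h[OF z(2)] z(3) by (metis col_sym)
    moreover have "z \<noteq> h z" "z' \<noteq> h z" using h[OF z(1)] h[OF z(2)] z(3) by auto
    ultimately show "z = z'" using col_eqD[of "h z" z z'] by blast
  qed
  moreover have "h ` ?S \<subseteq> B" using h by blast
  ultimately show ?thesis using assms(1) by (rule card_inj_on_le)
qed

end

section \<open>Scales, rich vertices and popular colours\<close>

locale big_clique = coloured_clique V col for V :: "'a set" and col :: "'a \<Rightarrow> 'a \<Rightarrow> 'c" +
  fixes b m :: nat
  assumes b1: "1000 * b \<le> card V" and b2: "card V \<le> 1001 * b" and b3: "1000 \<le> b"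
    and m1: "1 \<le> m" and m2: "1000 * m \<le> b"
begin

text \<open>The threshold b/10 is about n/10000. By \<open>card_outside\<close> a vertex that is not
  rich sees all but fewer than b/10 of the colours of \<open>r\<close>.\<close>

definition rich :: "'a \<Rightarrow> 'a set" where
  "rich r = {z \<in> V - {r}. b \<le> 10 * card (outside r z)}"

text \<open>About a tenth of all vertices, well above the 20 b vertices which coincidences may spoil
  in \<open>link\<close>.\<close>

definition popular :: "'c \<Rightarrow> bool" where
  "popular q \<longleftrightarrow> 100 * b \<le> card {z \<in> V. has_col z q}"

end

section \<open>Building one spider\<close>

text \<open>The vertices in \<open>T\<close> are the roots of all spiders, those in \<open>F\<close> must be detached from \<open>r\<close>,
  and \<open>E\<close> consists of the edges outside the stars which the other spiders use or reserve.\<close>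

locale spider_step = big_clique V col b m for V :: "'a set" and col :: "'a \<Rightarrow> 'a \<Rightarrow> 'c" and b m +
  fixes r :: 'a and T F :: "'a set" and A :: "'a \<Rightarrow> 'a set" and E :: "'a \<Rightarrow> 'a \<Rightarrow> bool"
  assumes rT: "r \<in> T" and TV: "T \<subseteq> V" and cT: "card T \<le> m" and FT: "F \<subseteq> T - {r}"
    and AV: "f \<in> F \<Longrightarrow> A f \<subseteq> V - {f}" and cA: "f \<in> F \<Longrightarrow> 700 * m \<le> card (A f)"
    and degE: "u \<in> V \<Longrightarrow> card {v \<in> V. E u v} \<le> m"
    and colE: "card {z \<in> V. \<exists>v\<in>V. E z v \<and> col z v = q} \<le> 2 * m"
begin

lemma rV: "r \<in> V" using rT TV by blast
lemma finT: "finite T" using TV finV finite_subset by blast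

section \<open>Partial spiders and their extension\<close>

text \<open>By properness \<open>K\<close> excludes at most \<open>card K\<close> neighbours of
  \<open>p\<close>, and by \<open>degE\<close> the relation \<open>E\<close> excludes at most
  \<open>m\<close>. The greedy choices of new neighbours rest on this count.\<close>

lemma pick:
  assumes p: "p \<in> V" and S: "S \<subseteq> V - {p}" and fin: "finite B" "finite K"
    and c: "card B + card K + m < card S"
  obtains j where "j \<in> S" "j \<notin> B" "\<not> E p j" "col p j \<notin> K"
proof -
  have "\<exists>j\<in>S. j \<notin> B \<and> \<not> E p j \<and> col p j \<notin> K"
  proof (rule ccontr)
    assume "\<not> ?thesis"
    then have "S \<subseteq> B \<union> ({v \<in> V. E p v} \<union> {v \<in> V - {p}. col p v \<in> K})" using S by blast
    then have "card S \<le> card (B \<union> ({v \<in> V. E p v} \<union> {v \<in> V - {p}. col p v \<in> K}))"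
      using fin finV by (intro card_mono) auto
    also have "\<dots> \<le> card B + (card {v \<in> V. E p v} + card {v \<in> V - {p}. col p v \<in> K})"
      by (meson add_left_mono card_Un_le le_trans)
    also have "\<dots> \<le> card B + (m + card K)" using degE[OF p] card_col_le[OF p fin(2)] by linarith
    finally show False using c by simp
  qed
  then show ?thesis using that by blast
qed

text \<open>\<open>X\<close> consists of the detached vertices, \<open>x \<in> X\<close> being re-attached to \<open>g x\<close>, and \<open>P\<close> of
  the pending ones: they are detached, so that their colours at \<open>r\<close> are available, but not yet
  re-attached.\<close>

definition partial_spider :: "'a set \<Rightarrow> ('a \<Rightarrow> 'a) \<Rightarrow> 'a set \<Rightarrow> bool" where
  "partial_spider X g P \<longleftrightarrow> X \<subseteq> V - {r} \<and> P \<subseteq> V - {r} \<and> X \<inter> P = {} \<and> inj_on g X \<and> g ` X \<subseteq> V \<and>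
     g ` X \<inter> (X \<union> P \<union> T) = {} \<and> (X \<union> P) \<inter> T \<subseteq> F \<and> inj_on (\<lambda>x. col x (g x)) X \<and>
     (\<forall>x\<in>X. \<not> E x (g x)) \<and> (\<forall>x\<in>X. \<forall>v\<in>V - {r} - X - P. col x (g x) \<noteq> col r v) \<and> (\<forall>x\<in>X \<inter> F. g x \<in> A x)"

definition cols :: "'a set \<Rightarrow> ('a \<Rightarrow> 'a) \<Rightarrow> 'c set" where
  "cols X g = (\<lambda>x. col x (g x)) ` X"

lemma partial_spiderD:
  assumes "partial_spider X g P"
  shows "X \<subseteq> V - {r}" "P \<subseteq> V - {r}" "X \<inter> P = {}" "inj_on g X" "g ` X \<subseteq> V"
    "g ` X \<inter> (X \<union> P \<union> T) = {}" "(X \<union> P) \<inter> T \<subseteq> F" "inj_on (\<lambda>x. col x (g x)) X"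
    "\<And>x. x \<in> X \<Longrightarrow> \<not> E x (g x)"
    "\<And>x v. x \<in> X \<Longrightarrow> v \<in> V - {r} - X - P \<Longrightarrow> col x (g x) \<noteq> col r v"
    "\<And>x. x \<in> X \<Longrightarrow> x \<in> F \<Longrightarrow> g x \<in> A x"
    "finite X" "finite P"
proof -
  show "finite X" "finite P" using assms finV by (auto simp: partial_spider_def intro: finite_subset)
qed (use assms in \<open>simp_all add: partial_spider_def\<close>)

text \<open>Detaching a vertex only frees colours, so no colour has to be checked. A vertex to which
  another one has been re-attached must stay joined to \<open>r\<close>, whence the condition on the
  image of \<open>g\<close>.\<close>

lemma partial_spider_add:
  assumes "partial_spider X g P" "y \<in> V" "y \<notin> X" "y \<notin> g ` X" "y \<notin> T"
  shows "partial_spider X g (insert y P)"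
proof -
  note s = partial_spiderD[OF assms(1)]
  show ?thesis unfolding partial_spider_def
  proof (intro conjI ballI)
    show "insert y P \<subseteq> V - {r}" using s(2) assms rT by auto
    show "g ` X \<inter> (X \<union> insert y P \<union> T) = {}" using s(6) assms by auto
    show "(X \<union> insert y P) \<inter> T \<subseteq> F" using s(7) assms by auto
    fix x v assume "x \<in> X" "v \<in> V - {r} - X - insert y P"
    then show "col x (g x) \<noteq> col r v" using s(10)[of x v] by simp
  qed (use s assms in auto)
qed

lemma image_fun_upd_insert: "p \<notin> X \<Longrightarrow> (g(p := j)) ` insert p X = insert j (g ` X)"
  by auto

lemma cols_upd: "p \<notin> X \<Longrightarrow> cols (insert p X) (g(p := j)) = insert (col p j) (cols X g)"
  unfolding cols_def by auto

lemma partial_spider_match: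
  assumes st: "partial_spider X g P" and p: "p \<in> P" and j: "j \<in> V" "j \<notin> X" "j \<notin> P" "j \<notin> g ` X" "j \<notin> T"
    and E: "\<not> E p j" and c: "col p j \<notin> cols X g"
    and fr: "\<And>v. v \<in> V - {r} - X - P \<Longrightarrow> col p j \<noteq> col r v" and F: "p \<in> F \<Longrightarrow> j \<in> A p"
  shows "partial_spider (insert p X) (g(p := j)) (P - {p})"
proof -
  have pX: "p \<notin> X" using st p by (auto simp: partial_spider_def)
  define g' where "g' = g(p := j)"
  have eq: "g' x = g x" if "x \<in> X" for x using that pX by (auto simp: g'_def)
  have gp: "g' p = j" by (simp add: g'_def)
  have img: "g' ` insert p X = insert j (g ` X)" unfolding g'_def by (rule image_fun_upd_insert[OF pX])
  note s = partial_spiderD[OF st]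
  have "partial_spider (insert p X) g' (P - {p})"
    unfolding partial_spider_def img
  proof (intro conjI ballI)
    have "inj_on g' X" using s(4) inj_on_cong[of X g' g] eq by simp
    moreover have "j \<notin> g' ` X" using j(4) eq by auto
    ultimately show "inj_on g' (insert p X)" using pX gp by (simp add: inj_on_insert)
    have "inj_on (\<lambda>x. col x (g' x)) X"
      by (subst inj_on_cong[of X _ "\<lambda>x. col x (g x)"]) (simp add: eq, rule s(8))
    moreover have "col p j \<notin> (\<lambda>x. col x (g' x)) ` X"
    proof
      assume "col p j \<in> (\<lambda>x. col x (g' x)) ` X"
      then obtain x where "x \<in> X" "col p j = col x (g' x)" by blast
      then show False using c eq[of x] by (auto simp: cols_def)
    qed
    ultimately show "inj_on (\<lambda>x. col x (g' x)) (insert p X)" using pX gp by (simp add: inj_on_insert)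
    show "insert p X \<subseteq> V - {r}" using s(1,2) p by auto
    show "insert p X \<inter> (P - {p}) = {}" using s(3) by auto
    show "insert j (g ` X) \<inter> (insert p X \<union> (P - {p}) \<union> T) = {}" using s(6) p j by auto
    show "(insert p X \<union> (P - {p})) \<inter> T \<subseteq> F" using s(7) p by auto
    show "insert j (g ` X) \<subseteq> V" using s(5) j by auto
    show "P - {p} \<subseteq> V - {r}" using s(2) by auto
  next
    fix x assume x: "x \<in> insert p X"
    show "\<not> E x (g' x)" using x s(9) E eq gp by (cases "x = p") auto
    fix v assume v: "v \<in> V - {r} - insert p X - (P - {p})"
    then have v': "v \<in> V - {r} - X - P" by auto
    show "col x (g' x) \<noteq> col r v"
    proof (cases "x = p")
      case True then show ?thesis using fr[OF v'] gp by simp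
    next
      case False then show ?thesis using s(10)[OF _ v', of x] x eq by simp
    qed
  next
    fix x assume "x \<in> insert p X \<inter> F"
    then show "g' x \<in> A x" using s(11)[of x] F eq gp by (cases "x = p") auto
  qed
  then show ?thesis unfolding g'_def .
qed


section \<open>Re-attaching the earlier roots\<close>

lemma card_F: "card F < m"
proof -
  have "card F < card T" using FT rT finT by (intro psubset_card_mono) auto
  then show ?thesis using cT by simp
qed

text \<open>Otherwise the edges from \<open>j\<close> to \<open>y\<close> and to \<open>r\<close>
  would share a colour. So the vertex that a re-attachment forces out of the star is never the new
  neighbour itself.\<close>

lemma col_link_neq:
  assumes "y \<in> V" "j \<in> V" "j \<noteq> y" "j \<noteq> r" "y \<noteq> r" "col y j = col r z"
  shows "j \<noteq> z"
proof
  assume "j = z"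
  then have "col j y = col j r" using assms(6) col_sym by metis
  then show False using assms proper[of j y r] rV by simp
qed

lemma col_root_neq: "x \<in> V \<Longrightarrow> z \<in> V \<Longrightarrow> x \<noteq> r \<Longrightarrow> z \<noteq> r \<Longrightarrow> x \<noteq> z \<Longrightarrow> col r x \<noteq> col r z"
  using proper[of r x z] rV by blast

lemma card_cols_le: "finite X \<Longrightarrow> card (cols X g) \<le> card X"
  unfolding cols_def by (rule card_image_le)

lemma finite_cols: "finite X \<Longrightarrow> finite (cols X g)"
  unfolding cols_def by simp

lemma link:
  assumes st: "partial_spider X g P" and y: "y \<in> P" "y \<notin> T" and PF: "P - {y} \<subseteq> F" and cX: "card X \<le> 4 * m"
    and q: "50 * b \<le> card (rich r) \<or>
      (popular q \<and> q \<notin> cols X g \<and> (\<exists>x\<in>X \<union> P. q = col r x) \<and> card (coincidences r q y) < 20 * b)"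
  shows "\<exists>X' g'. partial_spider X' g' (P - {y}) \<and> insert y X \<subseteq> X' \<and> card X' \<le> card X + 2 \<and>
     cols X' g' \<subseteq> cols X g \<union> {q} \<union> col r ` (V - {r} - X - P) \<union> - star_cols r"
proof -
  note s = partial_spiderD[OF st]
  define B where "B = X \<union> g ` X \<union> T \<union> {y}"
  have finB: "finite B" using s finT by (simp add: B_def)
  have PB: "P \<subseteq> B" and rB: "r \<in> B" using PF FT rT by (auto simp: B_def)
  have BV: "B \<subseteq> V" using s(1,2,5) TV y by (auto simp: B_def)
  have yV: "y \<in> V" and yr: "y \<noteq> r" and yX: "y \<notin> X" using s(2,3) y by auto
  have cB: "card B \<le> 9 * m + 1"
  proof -
    have "card B \<le> card X + card (g ` X) + card T + 1"
      unfolding B_def using card_Un_le[of "X \<union> g ` X \<union> T" "{y}"] card_Un_le[of "X \<union> g ` X" T] card_Un_le[of X "g ` X"]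
        is_singletonI[of y, THEN is_singleton_altdef[THEN iffD1]] by linarith
    also have "\<dots> \<le> 4 * m + 4 * m + m + 1"
      using cX cT card_image_le[OF s(12), of g] by (intro add_mono) auto
    finally show ?thesis by simp
  qed
  have finK: "finite (cols X g)" and cK: "card (cols X g) \<le> 4 * m"
    using finite_cols[OF s(12), of g] card_cols_le[OF s(12), of g] cX by simp_all
  show ?thesis
  proof (cases "b \<le> 10 * card (outside r y)")
    case True
    then have "card B + card (cols X g) + m < card (outside r y)" using cB cK m1 m2 by linarith
    from pick[OF yV outside_subset finB finK this]
    obtain j where j: "j \<in> outside r y" "j \<notin> B" "\<not> E y j" "col y j \<notin> cols X g" by blast
    have out: "col y j \<notin> star_cols r" using j by (simp add: outside_def)
    have "partial_spider (insert y X) (g(y := j)) (P - {y})"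
    proof (rule partial_spider_match[OF st y(1)])
      show "j \<in> V" using j by (simp add: outside_def)
      show "j \<notin> P" using j PB by auto
      show "col y j \<noteq> col r v" if "v \<in> V - {r} - X - P" for v
        using out that by (auto simp: star_cols_def)
    qed (use j y FT in \<open>auto simp: B_def\<close>)
    moreover have "cols (insert y X) (g(y := j)) = insert (col y j) (cols X g)"
      by (rule cols_upd[OF yX])
    moreover have "card (insert y X) \<le> card X + 2" using yX s(12) by simp
    ultimately show ?thesis using out by (intro exI[of _ "insert y X"] exI[of _ "g(y := j)"]) auto
  next
    case False
    \<comment> \<open>The parameter \<open>j\<close> is present because the two new edges y--j and
      z--k must not meet in k = j.\<close>
    define good where "good z j k \<longleftrightarrow> k \<in> V \<and> k \<notin> B \<and> k \<noteq> z \<and> k \<noteq> j \<and> \<not> E z k \<and> col z k \<notin> cols X g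
       \<and> (col z k = q \<and> (\<exists>x\<in>X \<union> P. q = col r x) \<or> col z k \<notin> star_cols r)" for z j k
    define G where "G = {z \<in> V - {r}. z \<notin> B \<and> (\<forall>j\<in>V - {y}. col y j = col r z \<longrightarrow> (\<exists>k. good z j k))}"
    have "25 * b \<le> card G"
    proof (cases "50 * b \<le> card (rich r)")
      case rich: True
      have "rich r - B \<subseteq> G"
      proof
        fix z assume z: "z \<in> rich r - B"
        have "\<exists>k. good z j k" if "j \<in> V - {y}" for j
        proof -
          have zV: "z \<in> V" "z \<noteq> r" and zo: "b \<le> 10 * card (outside r z)" using z by (auto simp: rich_def)
          have "card (insert z (insert j B)) \<le> card B + 2" using finB by (simp add: card_insert_if)
          then have "card (insert z (insert j B)) + card (cols X g) + m < card (outside r z)"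
            using cB cK m1 m2 zo by linarith
          from pick[OF zV(1) outside_subset _ finK this] finB
          obtain k where "k \<in> outside r z" "k \<notin> insert z (insert j B)" "\<not> E z k" "col z k \<notin> cols X g" by auto
          then have "good z j k" by (auto simp: good_def outside_def)
          then show ?thesis ..
        qed
        then show "z \<in> G" using z by (auto simp: G_def rich_def)
      qed
      then have "card (rich r - B) \<le> card G" using finV by (intro card_mono) (auto simp: G_def)
      moreover have "card (rich r) - card B \<le> card (rich r - B)" by (rule diff_card_le_card_Diff[OF finB])
      ultimately show ?thesis using rich cB m1 m2 by linarith
    next
      case poor: False
      with q have q: "popular q" "q \<notin> cols X g" "\<exists>x\<in>X \<union> P. q = col r x" "card (coincidences r q y) < 20 * b" by auto
      \<comment> \<open>In \<open>N\<close> and \<open>M\<close> the edge of colour \<open>q\<close>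
        leads into \<open>B\<close> or belongs to another spider. Together with \<open>B\<close>
        they have at most 20 m + 2 elements; with fewer than 20 b coincidences this leaves more than
        25 b of the 100 b vertices that see \<open>q\<close>.\<close>
      define N where "N = {z \<in> V. \<exists>k\<in>B. k \<noteq> z \<and> col z k = q}"
      define M where "M = {z \<in> V. \<exists>v\<in>V. E z v \<and> col z v = q}"
      have "{z \<in> V. has_col z q} - (B \<union> N \<union> M \<union> coincidences r q y) \<subseteq> G"
      proof
        fix z assume z: "z \<in> {z \<in> V. has_col z q} - (B \<union> N \<union> M \<union> coincidences r q y)"
        then obtain k where k: "k \<in> V" "k \<noteq> z" "col z k = q" by (auto simp: has_col_def star_cols_def)
        have "good z j k" if j: "j \<in> V - {y}" "col y j = col r z" for j
          unfolding good_def
        proof (intro conjI)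
          show "k \<notin> B" using z k by (auto simp: N_def)
          show "\<not> E z k" using z k by (auto simp: M_def)
          show "k \<noteq> j"
          proof
            assume "k = j"
            then have "z \<in> coincidences r q y" using z k j rB by (auto simp: coincidences_def)
            then show False using z by simp
          qed
        qed (use k q in auto)
        then show "z \<in> G" using z rB by (auto simp: G_def)
      qed
      then have "card ({z \<in> V. has_col z q} - (B \<union> N \<union> M \<union> coincidences r q y)) \<le> card G"
        using finV by (intro card_mono) (auto simp: G_def)
      moreover have "card {z \<in> V. has_col z q} - card (B \<union> N \<union> M \<union> coincidences r q y) \<le>
          card ({z \<in> V. has_col z q} - (B \<union> N \<union> M \<union> coincidences r q y))"
        using finB finV by (intro diff_card_le_card_Diff) (auto simp: N_def M_def coincidences_def)
      moreover have "card (B \<union> N \<union> M \<union> coincidences r q y) \<le> card B + card N + card M + card (coincidences r q y)"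
        using card_Un_le[of "B \<union> N \<union> M" "coincidences r q y"] card_Un_le[of "B \<union> N" M] card_Un_le[of B N] by linarith
      moreover have "card N \<le> card B" unfolding N_def by (rule card_col_nbr_le[OF finB BV])
      moreover have "card M \<le> 2 * m" unfolding M_def by (rule colE)
      ultimately show ?thesis using q(1,4) cB m1 m2 unfolding popular_def by linarith
    qed
    moreover have "G \<subseteq> V - {r}" by (auto simp: G_def)
    note card_link_ge[OF rV yV this]
    ultimately have "card B + card (cols X g) + m < card {j \<in> V - {y}. col y j \<in> col r ` G}"
      using False cB cK m1 m2 by linarith
    from pick[OF yV _ finB finK this]
    obtain j where j: "j \<in> V" "j \<noteq> y" "col y j \<in> col r ` G" "j \<notin> B" "\<not> E y j" "col y j \<notin> cols X g" by blast
    then obtain z where z: "z \<in> G" "col y j = col r z" by blast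
    then obtain k where k: "good z j k" using j by (auto simp: G_def)
    have zV: "z \<in> V" "z \<noteq> r" "z \<notin> B" using z by (auto simp: G_def)
    have jz: "j \<noteq> z" using col_link_neq[OF yV j(1,2) _ yr z(2)] j(4) rB by auto
    have st1: "partial_spider X g (insert z P)" using zV by (intro partial_spider_add[OF st]) (auto simp: B_def)
    have st2: "partial_spider (insert y X) (g(y := j)) (insert z P - {y})"
    proof (rule partial_spider_match[OF st1])
      show "j \<notin> insert z P" using j jz PB by auto
      show "col y j \<noteq> col r v" if "v \<in> V - {r} - X - insert z P" for v
        using col_root_neq[of z v] that zV z by auto
    qed (use j y FT in \<open>auto simp: B_def\<close>)
    have c2: "cols (insert y X) (g(y := j)) = insert (col r z) (cols X g)"
      using cols_upd[OF yX] z by simp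
    have zX: "z \<notin> insert y X" using zV by (auto simp: B_def)
    have kq: "col z k = q \<and> (\<exists>x\<in>X \<union> P. q = col r x) \<or> col z k \<notin> star_cols r" using k by (auto simp: good_def)
    have kz: "col z k \<noteq> col r z"
    proof -
      have "col r x \<noteq> col r z" if "x \<in> X \<union> P" for x
      proof (rule col_root_neq)
        show "x \<noteq> z" using that zV PB by (auto simp: B_def)
      qed (use that zV s(1,2) in auto)
      then show ?thesis using kq zV by (auto simp: star_cols_def)
    qed
    have img2: "(g(y := j)) ` insert y X = insert j (g ` X)" by (rule image_fun_upd_insert[OF yX])
    have st3: "partial_spider (insert z (insert y X)) (g(y := j, z := k)) (insert z P - {y} - {z})"
    proof (rule partial_spider_match[OF st2])
      show "z \<in> insert z P - {y}" using zV by (auto simp: B_def)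
      show "k \<notin> (g(y := j)) ` insert y X" unfolding img2 using k by (auto simp: good_def B_def)
      show "col z k \<notin> cols (insert y X) (g(y := j))" unfolding c2 using k kz by (auto simp: good_def)
      show "col z k \<noteq> col r v" if v: "v \<in> V - {r} - insert y X - (insert z P - {y})" for v
      proof -
        have "col r x \<noteq> col r v" if "x \<in> X \<union> P" for x
        proof (rule col_root_neq)
          show "x \<noteq> v" using that v zV PB by (auto simp: B_def)
        qed (use that v s(1,2) in auto)
        then show ?thesis using kq v by (auto simp: star_cols_def)
      qed
      show "z \<in> F \<Longrightarrow> k \<in> A z" using zV FT by (auto simp: B_def)
    qed (use k PB in \<open>auto simp: good_def B_def\<close>)
    have "insert z P - {y} - {z} = P - {y}" using zV PB by auto
    with st3 have "partial_spider (insert z (insert y X)) (g(y := j, z := k)) (P - {y})" by simp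
    moreover have "cols (insert z (insert y X)) (g(y := j, z := k)) = insert (col z k) (insert (col r z) (cols X g))"
      using cols_upd[OF zX] c2 by simp
    moreover have "card (insert z (insert y X)) \<le> card X + 2" using s(12) by (simp add: card_insert_if)
    moreover have "col r z \<in> col r ` (V - {r} - X - P)" using zV PB by (auto simp: B_def)
    ultimately show ?thesis using kq
      by (intro exI[of _ "insert z (insert y X)"] exI[of _ "g(y := j, z := k)"]) auto
  qed
qed


text \<open>The new neighbour of \<open>f\<close> has to lie in \<open>A f\<close>, so its colour
  cannot be prescribed. If it is the colour of some r--y, then y is passed to \<open>link\<close>
  together with the freed popular colour of r--uu f, which is kept for \<open>f\<close>. In
  \<open>legs_exist\<close>, \<open>uu f\<close> is \<open>f\<close> itself or, if the colour of
  r--f is unpopular, a reserved vertex. The last conjunct preserves the colours kept for the other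
  pending roots.\<close>

lemma forced_step:
  assumes st: "partial_spider X g P" and f: "f \<in> P" and PF: "P \<subseteq> F" and cX: "card X + 3 \<le> 4 * m"
    and prot: "50 * b \<le> card (rich r) \<or>
     inj_on uu F \<and> (\<forall>f\<in>P. popular (col r (uu f)) \<and> uu f \<in> X \<union> P \<and> col r (uu f) \<notin> cols X g)"
  shows "\<exists>X' g'. partial_spider X' g' (P - {f}) \<and> insert f X \<subseteq> X' \<and> card X' \<le> card X + 3 \<and>
    (50 * b \<le> card (rich r) \<or> (\<forall>f'\<in>P - {f}. col r (uu f') \<notin> cols X' g'))"
proof -
  note s = partial_spiderD[OF st]
  \<comment> \<open>For these y the colour kept for \<open>f\<close> would meet too many
    coincidences in \<open>link\<close>. There are at most 1001/20 of them, and \<open>K\<close>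
    forbids their colours at \<open>r\<close>, so none of them becomes pending.\<close>
  define bad where "bad = {y \<in> V. \<not> 50 * b \<le> card (rich r) \<and> 20 * b \<le> card (coincidences r (col r (uu f)) y)}"
  define B where "B = X \<union> g ` X \<union> T"
  have finB: "finite B" and finbad: "finite bad" using s finT finV by (auto simp: B_def bad_def)
  have PB: "P \<subseteq> B" and rB: "r \<in> B" and BV: "B \<subseteq> V"
    using PF FT rT s(1,5) TV by (auto simp: B_def)
  have fF: "f \<in> F" and fV: "f \<in> V" and fr: "f \<noteq> r" and fX: "f \<notin> X" using f PF s(2,3) by auto
  have cB: "card B \<le> 9 * m"
    using cX cT card_image_le[OF s(12), of g] card_Un_le[of "X \<union> g ` X" T] card_Un_le[of X "g ` X"]
    unfolding B_def by linarith
  have cbad: "card bad \<le> 51"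
  proof -
    have "card bad * (20 * b) \<le> card {y \<in> V. 20 * b \<le> card (coincidences r (col r (uu f)) y)} * (20 * b)"
      using finV by (intro mult_le_mono1 card_mono) (auto simp: bad_def)
    also have "\<dots> \<le> card V" by (rule card_many_coincidences)
    also have "\<dots> \<le> 1001 * b" by (rule b2)
    finally have "20 * card bad \<le> 1001" using b3 by (simp add: mult.assoc[symmetric])
    then show ?thesis by simp
  qed
  define K where "K = cols X g \<union> col r ` ((B \<union> bad) - {r})"
  have finK: "finite K" using finB finbad s finite_cols by (simp add: K_def)
  have cK: "card K \<le> 13 * m + 51"
  proof -
    have "card K \<le> card (cols X g) + card (col r ` ((B \<union> bad) - {r}))"
      unfolding K_def by (rule card_Un_le)
    also have "\<dots> \<le> card X + card ((B \<union> bad) - {r})"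
      using finB finbad s by (intro add_mono card_cols_le card_image_le) auto
    also have "card ((B \<union> bad) - {r}) \<le> card (B \<union> bad)" using finB finbad by (intro card_mono) auto
    also have "\<dots> \<le> card B + card bad" by (rule card_Un_le)
    finally show ?thesis using cB cbad cX by simp
  qed
  have "card B + card K + m < card (A f)" using cA[OF fF] cB cK m1 by linarith
  from pick[OF fV AV[OF fF] finB finK this]
  obtain j where j: "j \<in> A f" "j \<notin> B" "\<not> E f j" "col f j \<notin> K" by blast
  have jV: "j \<in> V" "j \<noteq> f" using j AV[OF fF] by auto
  have notX: "col f j \<noteq> col r x" if "x \<in> X \<union> P" for x
  proof -
    have "x \<in> (B \<union> bad) - {r}" using that PB s(1,2) by (auto simp: B_def)
    then show ?thesis using j(4) by (auto simp: K_def)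
  qed
  have jc: "col f j \<notin> cols X g" using j by (simp add: K_def)
  show ?thesis
  proof (cases "col f j \<in> star_cols r")
    case False
    have "partial_spider (insert f X) (g(f := j)) (P - {f})"
    proof (rule partial_spider_match[OF st f])
      show "j \<notin> P" using j PB by auto
      show "col f j \<noteq> col r v" if "v \<in> V - {r} - X - P" for v
        using that False by (auto simp: star_cols_def)
    qed (use j jV jc in \<open>auto simp: B_def\<close>)
    moreover have "cols (insert f X) (g(f := j)) = insert (col f j) (cols X g)"
      by (rule cols_upd[OF fX])
    moreover have "card (insert f X) \<le> card X + 3" using fX s(12) by simp
    moreover have "col r (uu f') \<noteq> col f j" if "uu f' \<in> X \<union> P" for f' using notX[OF that] by simp
    ultimately show ?thesis using prot
      by (intro exI[of _ "insert f X"] exI[of _ "g(f := j)"]) auto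
  next
    case True
    then obtain y where y: "y \<in> V" "y \<noteq> r" "col f j = col r y" by (auto simp: star_cols_def)
    have jy: "j \<noteq> y" using col_link_neq[OF fV jV _ fr y(3)] j(2) rB by auto
    have yB: "y \<notin> B" "y \<notin> bad" using y j(4) by (auto simp: K_def)
    have yP: "y \<notin> P" using yB PB by auto
    have st1: "partial_spider X g (insert y P)" using yB y by (intro partial_spider_add[OF st]) (auto simp: B_def)
    have st2: "partial_spider (insert f X) (g(f := j)) (insert y P - {f})"
    proof (rule partial_spider_match[OF st1])
      show "j \<notin> insert y P" using j jy PB by auto
      show "col f j \<noteq> col r v" if "v \<in> V - {r} - X - insert y P" for v
        using col_root_neq[of y v] that y by auto
    qed (use j f jV jc in \<open>auto simp: B_def\<close>)
    have c2: "cols (insert f X) (g(f := j)) = insert (col r y) (cols X g)"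
      using cols_upd[OF fX] y by simp
    have eqP: "insert y P - {f} - {y} = P - {f}" using yP by auto
    have eqXP: "insert f X \<union> (insert y P - {f}) = insert y (X \<union> P)" using f by auto
    have ry: "col r y \<noteq> col r x" if "x \<in> X \<union> P" for x using notX[OF that] y by simp
    have q2: "50 * b \<le> card (rich r) \<or> (popular (col r (uu f)) \<and> col r (uu f) \<notin> cols (insert f X) (g(f := j)) \<and>
       (\<exists>x\<in>insert f X \<union> (insert y P - {f}). col r (uu f) = col r x) \<and> card (coincidences r (col r (uu f)) y) < 20 * b)"
    proof (cases "50 * b \<le> card (rich r)")
      case False
      with prot f have p: "popular (col r (uu f))" "uu f \<in> X \<union> P" "col r (uu f) \<notin> cols X g" by auto
      have "card (coincidences r (col r (uu f)) y) < 20 * b" using yB(2) y(1) False by (simp add: bad_def)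
      moreover have "\<exists>x\<in>insert f X \<union> (insert y P - {f}). col r (uu f) = col r x"
        unfolding eqXP using p by blast
      moreover have "col r (uu f) \<notin> cols (insert f X) (g(f := j))" unfolding c2 using p ry[OF p(2)] by auto
      ultimately show ?thesis using p by blast
    qed simp
    have "\<exists>X' g'. partial_spider X' g' (insert y P - {f} - {y}) \<and> insert y (insert f X) \<subseteq> X' \<and> card X' \<le> card (insert f X) + 2 \<and>
     cols X' g' \<subseteq> cols (insert f X) (g(f := j)) \<union> {col r (uu f)} \<union>
        col r ` (V - {r} - insert f X - (insert y P - {f})) \<union> - star_cols r"
    proof (rule link[OF st2 _ _ _ _ q2])
      show "y \<in> insert y P - {f}" using yP f by auto
      show "y \<notin> T" using yB by (simp add: B_def)
      show "insert y P - {f} - {y} \<subseteq> F" using PF by auto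
      show "card (insert f X) \<le> 4 * m" using cX s(12) by (simp add: card_insert_if)
    qed
    then obtain X' g' where X': "partial_spider X' g' (P - {f})" "insert y (insert f X) \<subseteq> X'" "card X' \<le> card (insert f X) + 2"
      and cols': "cols X' g' \<subseteq> cols (insert f X) (g(f := j)) \<union> {col r (uu f)} \<union>
        col r ` (V - {r} - insert f X - (insert y P - {f})) \<union> - star_cols r"
      unfolding eqP by blast
    \<comment> \<open>This colour occurs at \<open>r\<close>, differs from the colours of r--uu f
      and r--y, and belongs to a vertex that is already detached. None of the sources of new colours
      listed by \<open>link\<close> contains it.\<close>
    have "col r (uu f') \<notin> cols X' g'" if poor: "\<not> 50 * b \<le> card (rich r)" and f': "f' \<in> P - {f}" for f'
    proof
      assume "col r (uu f') \<in> cols X' g'"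
      moreover have p: "uu f' \<in> X \<union> P" "col r (uu f') \<notin> cols X g" "inj_on uu F" "uu f \<in> X \<union> P"
        using prot poor f' f by auto
      have V': "uu f' \<in> V - {r}" "uu f \<in> V - {r}" using p s(1,2) by auto
      have "col r (uu f') \<in> star_cols r" using V' by (auto simp: star_cols_def)
      moreover have "uu f' \<noteq> uu f" using p(3) f' f PF by (auto dest: inj_onD)
      then have "col r (uu f') \<noteq> col r (uu f)" using col_root_neq V' by auto
      moreover have "col r (uu f') \<noteq> col r y" using ry[OF p(1)] by simp
      ultimately have "col r (uu f') \<in> col r ` (V - {r} - insert f X - (insert y P - {f}))"
        using cols' p(2) unfolding c2 by auto
      then obtain v where v: "v \<in> V - {r}" "v \<notin> insert f X \<union> (insert y P - {f})" "col r (uu f') = col r v" by auto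
      then have "uu f' = v" using col_root_neq V' by blast
      then show False using v(2) p(1) unfolding eqXP by simp
    qed
    moreover have "card X' \<le> card X + 3" using X'(3) s(12) fX by simp
    ultimately show ?thesis using X' by (intro exI[of _ X'] exI[of _ g']) auto
  qed
qed

text \<open>Each earlier root costs at most three legs: its own and the two of
  \<open>link\<close>.\<close>

lemma forced:
  assumes "partial_spider X g P" "P \<subseteq> F" "card X + 3 * card P \<le> 4 * m"
    and "50 * b \<le> card (rich r) \<or>
     inj_on uu F \<and> (\<forall>f\<in>P. popular (col r (uu f)) \<and> uu f \<in> X \<union> P \<and> col r (uu f) \<notin> cols X g)"
  shows "\<exists>X' g'. partial_spider X' g' {} \<and> X \<union> P \<subseteq> X' \<and> card X' \<le> 4 * m"
  using assms
proof (induction "card P" arbitrary: X g P)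
  case 0
  then have "P = {}" using partial_spiderD(13) by fastforce
  then show ?case using 0 by auto
next
  case (Suc k)
  have finP: "finite P" using partial_spiderD(13)[OF Suc.prems(1)] .
  obtain f where f: "f \<in> P" using Suc.hyps(2) by fastforce
  have cP: "card P = Suc (card (P - {f}))" by (rule card.remove[OF finP f])
  obtain X' g' where X': "partial_spider X' g' (P - {f})" "insert f X \<subseteq> X'" "card X' \<le> card X + 3"
    "50 * b \<le> card (rich r) \<or> (\<forall>f'\<in>P - {f}. col r (uu f') \<notin> cols X' g')"
    using forced_step[OF Suc.prems(1) f Suc.prems(2) _ Suc.prems(4)] Suc.prems(3) cP by auto
  have "\<exists>X'' g''. partial_spider X'' g'' {} \<and> X' \<union> (P - {f}) \<subseteq> X'' \<and> card X'' \<le> 4 * m"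
  proof (rule Suc.hyps(1)[OF _ X'(1)])
    show "k = card (P - {f})" using Suc.hyps(2) cP by simp
    show "P - {f} \<subseteq> F" using Suc.prems(2) by auto
    show "card X' + 3 * card (P - {f}) \<le> 4 * m" using X'(3) Suc.prems(3) cP by simp
    have "X \<union> P \<subseteq> X' \<union> (P - {f})" using X'(2) by auto
    then show "50 * b \<le> card (rich r) \<or> inj_on uu F \<and>
      (\<forall>f'\<in>P - {f}. popular (col r (uu f')) \<and> uu f' \<in> X' \<union> (P - {f}) \<and> col r (uu f') \<notin> cols X' g')"
      using X'(4) Suc.prems(4) by blast
  qed
  then show ?case using X'(2) by blast
qed

end

section \<open>Numerical bounds for the two hitting sets\<close>

lemma less_two_power: "20 \<le> b \<Longrightarrow> 1001 * b < (2::nat) ^ b"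
  by (induction b rule: nat_induct_at_least) auto

text \<open>As 1001 b < 2 ^ b, it suffices that 2 * 0.885 ^ 20 is at most 1/4, where 0.885 = 1 -
  0.23/2. In \<open>reserve\<close> this gives 2 b common elements with every useful
  neighbourhood.\<close>

lemma reserve_bound1: "20 \<le> b \<Longrightarrow> real (1001 * b) * (1 - (23/100) * (1 - 1/2)) ^ (20 * b) < (1/2) ^ (2 * b)"
proof -
  assume b: "20 \<le> b"
  have "real (1001 * b) < real (2 ^ b)" using less_two_power[OF b] by (simp only: of_nat_less_iff)
  then have "real (1001 * b) * (1 - (23/100) * (1 - 1/2)) ^ (20 * b) < 2 ^ b * (1 - (23/100) * (1 - 1/2)) ^ (20 * b)"
    by (intro mult_strict_right_mono) auto
  also have "\<dots> = (2 * (1 - (23/100) * (1 - 1/2)) ^ 20) ^ b"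
    by (simp add: power_mult power_mult_distrib)
  also have "\<dots> \<le> ((1/2) ^ 2) ^ b"
    by (intro power_mono) (auto simp: power_divide)
  finally show ?thesis by (simp add: power_mult)
qed

text \<open>The tenth power is at most 0.981, and 0.981 ^ 1000 is at most 0.39 ^ 20, which settles b
  = 1000; from there on the factor 0.981 (k + 1) / k is below 1. The fraction 0.00199 lies just
  below 2/1001, the least possible value of 2 b / n.\<close>

lemma reserve_bound2: "1000 \<le> b \<Longrightarrow> real (1001 * b) * (1 - (199/100000)) ^ (10 * b) < 1"
proof -
  define a :: real where "a = (1 - (199/100000)) ^ 10"
  have a: "0 \<le> a" "a \<le> 0.981" by (auto simp: a_def power_divide)
  have a50: "(0.981::real) ^ 50 \<le> 0.39" by (simp add: power_divide)
  have a20: "(0.39::real) ^ 20 * 1001000 < 1" by (simp add: power_divide)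
  have "1000 \<le> b \<Longrightarrow> real (1001 * b) * a ^ b < 1"
  proof (induction b rule: nat_induct_at_least)
    case base
    have "a ^ 1000 \<le> 0.981 ^ (50 * 20)" using a by (simp add: power_mono)
    also have "\<dots> = (0.981 ^ 50) ^ 20" by (rule power_mult)
    also have "\<dots> \<le> 0.39 ^ 20" by (intro power_mono a50) simp
    finally have "real (1001 * 1000) * a ^ 1000 \<le> 0.39 ^ 20 * 1001000" by simp
    then show ?case using a20 by linarith
  next
    case (Suc k)
    have "real (1001 * Suc k) * a \<le> real (1001 * Suc k) * 0.981"
      using a by (intro mult_left_mono) auto
    also have "\<dots> \<le> real (1001 * k)" using Suc.hyps by simp
    finally have "(real (1001 * Suc k) * a) * a ^ k \<le> real (1001 * k) * a ^ k"
      using a by (intro mult_right_mono) auto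
    then show ?case using Suc.IH by (simp add: mult_ac)
  qed
  then show "1000 \<le> b \<Longrightarrow> ?thesis" by (simp add: a_def power_mult)
qed

section \<open>The reserve that closes the chain\<close>

context spider_step begin

text \<open>A vertex that is not rich misses fewer than b/10 colours of \<open>r\<close>, so on
  average a colour of \<open>r\<close> is missing at about b/10 such vertices at most. Leaving out
  the small set \<open>B\<close> cannot raise this average to \<open>b\<close>. The colour found
  here is freed at the start of the chain and serves for closing it.\<close>

lemma start_vertex:
  assumes B: "finite B" "card B < b"
  obtains x where "x \<in> V" "x \<noteq> r" "x \<notin> B" "card {y \<in> V - {r} - rich r. \<not> has_col y (col r x)} \<le> b"
proof -
  define L where "L = V - {r} - rich r"
  define f where "f x = card {y \<in> L. \<not> has_col y (col r x)}" for x
  have "(\<Sum>x\<in>V - {r}. f x) = (\<Sum>y\<in>L. card (outside r y))"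
    unfolding f_def
    by (rule sum_multicount_gen) (auto simp: finV L_def card_outside[OF rV])
  moreover have "10 * (\<Sum>y\<in>L. card (outside r y)) \<le> (\<Sum>y\<in>L. b)"
    unfolding sum_distrib_left by (intro sum_mono) (auto simp: L_def rich_def)
  moreover have "\<dots> \<le> card V * b" using finV by (auto simp: L_def intro!: card_mono)
  ultimately have "10 * (\<Sum>x\<in>V - {r}. f x) \<le> card V * b" by linarith
  also have "\<dots> \<le> 1001 * b * b" using b2 by simp
  finally have up: "10 * (\<Sum>x\<in>V - {r}. f x) \<le> 1001 * b * b" .
  have "\<exists>x\<in>V - {r} - B. f x \<le> b"
  proof (rule ccontr)
    assume neg: "\<not> ?thesis"
    have "900 * b * b \<le> card (V - {r} - B) * b"
    proof (rule mult_le_mono1)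
      have eq: "V - {r} - B = V - insert r B" by auto
      have "card V - card (insert r B) \<le> card (V - insert r B)"
        using B by (intro diff_card_le_card_Diff) auto
      moreover have "card (insert r B) \<le> Suc (card B)" using B by (simp add: card_insert_if)
      ultimately show "900 * b \<le> card (V - {r} - B)" unfolding eq using b1 B b3 by linarith
    qed
    also have "\<dots> = (\<Sum>x\<in>V - {r} - B. b)" by simp
    also have "\<dots> \<le> (\<Sum>x\<in>V - {r} - B. f x)" using neg by (intro sum_mono) force
    also have "\<dots> \<le> (\<Sum>x\<in>V - {r}. f x)" using finV by (intro sum_mono2) auto
    finally have "9000 * b * b \<le> 1001 * b * b" using up by linarith
    then show False using b3 by simp
  qed
  then show ?thesis using that unfolding f_def L_def by blast
qed

text \<open>Rich vertices get an edge in an absent colour. For the others the edge of colour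
  \<open>q\<close> will do unless it leads into \<open>B\<close> or belongs to \<open>E\<close>,
  which excludes at most 10 m + 2 m vertices. Many z may share the colour \<open>q\<close>, since
  only one of these edges will be used in the end.\<close>

lemma closers:
  assumes B: "finite B" "B \<subseteq> V" "card B \<le> 10 * m" and K: "finite K" "card K \<le> 4 * m" "q \<notin> K"
    and Z: "Z \<subseteq> V" "\<And>z. z \<in> Z \<Longrightarrow> z \<in> rich r \<or> has_col z q"
  obtains C h where "C \<subseteq> Z" "card Z \<le> card C + 12 * m"
    "\<And>z. z \<in> C \<Longrightarrow> h z \<in> V \<and> h z \<noteq> z \<and> h z \<notin> B \<and> \<not> E z (h z) \<and> col z (h z) \<notin> K
        \<and> (col z (h z) = q \<or> col z (h z) \<notin> star_cols r)"
proof -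
  define good where "good z k \<longleftrightarrow> k \<in> V \<and> k \<noteq> z \<and> k \<notin> B \<and> \<not> E z k \<and> col z k \<notin> K
        \<and> (col z k = q \<or> col z k \<notin> star_cols r)" for z k
  define C where "C = {z \<in> Z. \<exists>k. good z k}"
  define N where "N = {z \<in> V. \<exists>k\<in>B. k \<noteq> z \<and> col z k = q}"
  define M where "M = {z \<in> V. \<exists>v\<in>V. E z v \<and> col z v = q}"
  have "Z - (N \<union> M) \<subseteq> C"
  proof
    fix z assume z: "z \<in> Z - (N \<union> M)"
    then have zV: "z \<in> V" using Z by auto
    have "\<exists>k. good z k"
    proof (cases "z \<in> rich r")
      case True
      then have "card B + card K + m < card (outside r z)"
        using B(3) K(2) m1 m2 unfolding rich_def by simp
      from pick[OF zV outside_subset B(1) K(1) this] show ?thesis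
        by (metis (mono_tags, lifting) Diff_iff good_def insertI1 mem_Collect_eq outside_def)
    next
      case False
      then obtain k where "k \<in> V" "k \<noteq> z" "col z k = q"
        using Z(2)[of z] z by (auto simp: has_col_def star_cols_def)
      then have "good z k" using z zV K(3) by (auto simp: good_def N_def M_def)
      then show ?thesis ..
    qed
    then show "z \<in> C" using z by (simp add: C_def)
  qed
  then have "card (Z - (N \<union> M)) \<le> card C"
    using Z(1) finV by (intro card_mono) (auto simp: C_def intro: finite_subset)
  moreover have "card Z - card (N \<union> M) \<le> card (Z - (N \<union> M))"
    using finV by (intro diff_card_le_card_Diff) (auto simp: N_def M_def)
  moreover have "card (N \<union> M) \<le> card N + card M" by (rule card_Un_le)
  moreover have "card N \<le> card B" unfolding N_def by (rule card_col_nbr_le[OF B(1,2)])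
  moreover have "card M \<le> 2 * m" unfolding M_def by (rule colE)
  ultimately have "card Z \<le> card C + 12 * m" using B(3) by linarith
  moreover have "good z (SOME k. good z k)" if "z \<in> C" for z
    by (rule someI_ex) (use that in \<open>simp add: C_def\<close>)
  ultimately show ?thesis
    using that[of C "\<lambda>z. SOME k. good z k"] unfolding good_def C_def by blast
qed

text \<open>\<open>R\<close> is chosen first, and so as to meet every useful neighbourhood 2 b times
  rather than once: the edges from x to these vertices have different colours and so point to 2 b
  different y. These sets of y are large enough to be hit by a set \<open>Y\<close> of only about 10
  b vertices. Both \<open>R\<close> and \<open>Y\<close> have to be small because the chain must
  avoid them.\<close>

lemma reserve:
  assumes C: "C \<subseteq> V - {r}" "card V \<le> card C + 4 * b" and h: "\<And>y. y \<in> C \<Longrightarrow> h y \<in> V"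
    and B: "finite B" "card B \<le> 10 * m"
  obtains Bn R Y where "Bn \<subseteq> V" "card Bn \<le> 20" "R \<subseteq> V - B" "card R \<le> 20 * b" "Y \<subseteq> C" "Y \<noteq> {}" "card Y \<le> 10 * b + 1"
    "\<And>x. x \<in> V \<Longrightarrow> x \<notin> Bn \<Longrightarrow> card (outside r x) < 680 * b \<Longrightarrow>
       \<exists>y\<in>Y. \<exists>j\<in>R. j \<noteq> x \<and> \<not> E x j \<and> col x j = col r y \<and> j \<noteq> h y"
proof -
  \<comment> \<open>In a clash the edge from x in the colour of r--y leads to h y, which is occupied
    if y is used. At h y this colour leads to one vertex only, so each y clashes with at most one x,
    and at most 1001/50 vertices x have 50 b clashes.\<close>
  define clash where "clash x y \<longleftrightarrow> h y \<noteq> x \<and> col x (h y) = col r y" for x y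
  define Bn where "Bn = {x \<in> V. 50 * b \<le> card {y \<in> C. clash x y}}"
  have finC: "finite C" using C finV finite_subset by blast
  have Bn: "Bn \<subseteq> V" "card Bn \<le> 20"
  proof -
    show "Bn \<subseteq> V" by (auto simp: Bn_def)
    have one: "card {x \<in> V. clash x y} \<le> 1" if y: "y \<in> C" for y
    proof -
      have "x = x'" if "x \<in> V" "x' \<in> V" "clash x y" "clash x' y" for x x'
        using that h[OF y] col_eqD[of "h y" x x'] col_sym[of "h y" x] col_sym[of "h y" x']
        by (auto simp: clash_def)
      then show ?thesis by (auto simp: card_le_Suc0_iff_eq finV)
    qed
    have "card Bn * (50 * b) = (\<Sum>x\<in>Bn. 50 * b)" by simp
    also have "\<dots> \<le> (\<Sum>x\<in>Bn. card {y \<in> C. clash x y})" by (intro sum_mono) (auto simp: Bn_def)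
    also have "\<dots> \<le> (\<Sum>x\<in>V. card {y \<in> C. clash x y})" using finV by (intro sum_mono2) (auto simp: Bn_def)
    also have "\<dots> = (\<Sum>y\<in>C. card {x \<in> V. clash x y})"
      by (rule sum_multicount_gen) (auto simp: finV finC)
    also have "\<dots> \<le> (\<Sum>y\<in>C. 1)" using one by (intro sum_mono)
    also have "\<dots> \<le> card V" using C finV by (auto intro: card_mono)
    also note b2
    finally have "(50 * card Bn) * b \<le> 1001 * b" by (simp add: mult_ac)
    then have "50 * card Bn \<le> 1001" using b3 by simp
    then show "card Bn \<le> 20" by simp
  qed
  define I where "I x = {j \<in> V - B - {x}. \<not> E x j \<and> (\<exists>y\<in>C. col x j = col r y \<and> j \<noteq> h y)}" for x
  define W where "W = {x \<in> V - Bn. card (outside r x) < 680 * b}"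
  have finW: "finite W" "card W \<le> 1001 * b"
    using finV b2 card_mono[of V W] by (auto simp: W_def)
  \<comment> \<open>\<open>C\<close> has at least 996 b elements; 50 b are lost to clashes, 680 b to
    colours missing at x, and at most 11 m to \<open>B\<close> and \<open>E\<close>.\<close>
  have Ibig: "260 * b \<le> card (I x)" if x: "x \<in> W" for x
  proof -
    have xV: "x \<in> V" using x by (simp add: W_def)
    define G where "G = {y \<in> C. \<not> clash x y}"
    have "card C = card {y \<in> C. clash x y} + card G" unfolding G_def by (rule card_filter_split[OF finC])
    moreover have "card {y \<in> C. clash x y} < 50 * b" using x by (auto simp: W_def Bn_def)
    moreover have "card G \<le> card {j \<in> V - {x}. col x j \<in> col r ` G} + card (outside r x)"
      using card_link_ge[OF rV xV, of G] C by (auto simp: G_def)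
    moreover have "card (outside r x) < 680 * b" using x by (simp add: W_def)
    moreover have "{j \<in> V - {x}. col x j \<in> col r ` G} - (B \<union> {v \<in> V. E x v}) \<subseteq> I x"
      by (auto simp: I_def G_def clash_def)
    then have "card ({j \<in> V - {x}. col x j \<in> col r ` G} - (B \<union> {v \<in> V. E x v})) \<le> card (I x)"
      using finV by (intro card_mono) (auto simp: I_def)
    moreover have "card {j \<in> V - {x}. col x j \<in> col r ` G} - card (B \<union> {v \<in> V. E x v}) \<le>
       card ({j \<in> V - {x}. col x j \<in> col r ` G} - (B \<union> {v \<in> V. E x v}))"
      using B finV by (intro diff_card_le_card_Diff) auto
    moreover have "card (B \<union> {v \<in> V. E x v}) \<le> card B + card {v \<in> V. E x v}" by (rule card_Un_le)
    moreover have "card {v \<in> V. E x v} \<le> m" by (rule degE[OF xV])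
    ultimately show ?thesis using C(2) B(2) b1 m2 by linarith
  qed
  have V0: "V \<noteq> {}" using rV by auto
  have IV: "I x \<subseteq> V" for x by (auto simp: I_def)
  have "\<exists>S\<subseteq>V. card S \<le> 20 * b \<and>
     (\<Sum>x\<in>W. (1/2) ^ card (I x \<inter> S)) \<le> card W * (1 - (23/100) * (1 - 1/2::real)) ^ (20 * b)"
  proof (rule multi_hit[OF finV V0 finW(1)])
    fix x S assume x: "x \<in> W" and S: "S \<subseteq> V" "card S < 20 * b"
    have "card (I x) - card S \<le> card (I x - S)"
      using S finV by (intro diff_card_le_card_Diff) (auto intro: finite_subset)
    then have "240 * b \<le> card (I x - S)" using Ibig[OF x] S by linarith
    then have "240 * real b \<le> real (card (I x - S))" by (simp flip: of_nat_le_iff[where 'a=real])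
    moreover have "(23/100) * real (card V) \<le> (23023/100) * real b"
      using b2 by (simp flip: of_nat_le_iff[where 'a=real])
    ultimately have "(23/100) * real (card V) \<le> real (card (I x - S))" by linarith
    then show "1/2 = (0::real) \<and> I x \<inter> S \<noteq> {} \<or> (23/100) * real (card V) \<le> real (card (I x - S))"
      by simp
  qed (use IV in auto)
  then obtain S where S: "S \<subseteq> V" "card S \<le> 20 * b"
    and Ssum: "(\<Sum>x\<in>W. (1/2) ^ card (I x \<inter> S)) \<le> card W * (1 - (23/100) * (1 - 1/2::real)) ^ (20 * b)" by blast
  have hit: "2 * b \<le> card (I x \<inter> S)" if x: "x \<in> W" for x
  proof (rule ccontr)
    assume "\<not> ?thesis"
    then have "(1/2::real) ^ (2 * b) \<le> (1/2) ^ card (I x \<inter> S)" by (intro power_decreasing) auto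
    also have "\<dots> \<le> (\<Sum>x\<in>W. (1/2) ^ card (I x \<inter> S))"
      using x finW by (intro member_le_sum) auto
    also note Ssum
    also have "card W * (1 - (23/100) * (1 - 1/2::real)) ^ (20 * b) \<le> real (1001 * b) * (1 - (23/100) * (1 - 1/2)) ^ (20 * b)"
      using finW by (intro mult_right_mono) (auto simp flip: of_nat_le_iff[where 'a=real])
    also have "\<dots> < (1/2) ^ (2 * b)" using b3 by (intro reserve_bound1) simp
    finally show False by simp
  qed
  define A2 where "A2 x = {y \<in> C. \<exists>j\<in>I x \<inter> S. col x j = col r y \<and> j \<noteq> h y}" for x
  have A2big: "2 * b \<le> card (A2 x)" if x: "x \<in> W" for x
  proof -
    have xV: "x \<in> V" using x by (simp add: W_def)
    have "inj_on (col x) (I x \<inter> S)" using inj_col[OF xV] by (rule inj_on_subset) (auto simp: I_def)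
    then have "card (I x \<inter> S) = card (col x ` (I x \<inter> S))" by (simp add: card_image)
    also have "\<dots> \<le> card (col r ` A2 x)"
      using finC by (intro card_mono) (auto simp: A2_def I_def)
    also have "\<dots> \<le> card (A2 x)" using finC by (intro card_image_le) (auto simp: A2_def)
    finally show ?thesis using hit[OF x] by simp
  qed
  have "\<exists>Y\<subseteq>V. card Y \<le> 10 * b \<and>
     (\<Sum>x\<in>W. 0 ^ card (A2 x \<inter> Y)) \<le> card W * (1 - (199/100000) * (1 - 0::real)) ^ (10 * b)"
  proof (rule multi_hit[OF finV V0 finW(1)])
    fix x Y assume x: "x \<in> W" and Y: "Y \<subseteq> V" "card Y < 10 * b"
    have "(199/100000) * real (card V) \<le> (199199/100000) * real b"
      using b2 by (simp flip: of_nat_le_iff[where 'a=real])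
    moreover have "2 * real b \<le> real (card (A2 x))" using A2big[OF x] by (simp flip: of_nat_le_iff[where 'a=real])
    ultimately have "(199/100000) * real (card V) \<le> real (card (A2 x))" by linarith
    then show "0 = (0::real) \<and> A2 x \<inter> Y \<noteq> {} \<or> (199/100000) * real (card V) \<le> real (card (A2 x - Y))"
      by (cases "A2 x \<inter> Y = {}") (auto simp: Diff_triv)
  qed (use C in \<open>auto simp: A2_def\<close>)
  then obtain Y where Y: "Y \<subseteq> V" "card Y \<le> 10 * b"
    and Ysum: "(\<Sum>x\<in>W. 0 ^ card (A2 x \<inter> Y)) \<le> card W * (1 - (199/100000)::real) ^ (10 * b)" by auto
  have finY: "finite Y" using Y finV finite_subset by blast
  have hitY: "A2 x \<inter> Y \<noteq> {}" if x: "x \<in> W" for x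
  proof
    assume "A2 x \<inter> Y = {}"
    then have "1 = (0::real) ^ card (A2 x \<inter> Y)" by simp
    also have "\<dots> \<le> (\<Sum>x\<in>W. 0 ^ card (A2 x \<inter> Y))"
      using x finW by (intro member_le_sum) auto
    also note Ysum
    also have "card W * (1 - (199/100000)::real) ^ (10 * b) \<le> real (1001 * b) * (1 - (199/100000)) ^ (10 * b)"
      using finW by (intro mult_right_mono) (auto simp flip: of_nat_le_iff[where 'a=real])
    also have "\<dots> < 1" using b3 by (intro reserve_bound2)
    finally show False by simp
  qed
  \<comment> \<open>\<open>Y\<close> must be non-empty in any case: a last pending vertex with many
    absent colours is closed with an arbitrary y.\<close>
  have "C \<noteq> {}" using C(2) b1 b3 by auto
  then obtain y0 where y0: "y0 \<in> C" by blast
  show ?thesis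
  proof (rule that[OF Bn, of "S - B" "insert y0 (C \<inter> Y)"])
    show "card (S - B) \<le> 20 * b" using S finV card_mono[of S "S - B"] finite_subset by fastforce
    have "card (C \<inter> Y) \<le> card Y" using finY by (intro card_mono) auto
    then show "card (insert y0 (C \<inter> Y)) \<le> 10 * b + 1" using Y finY by (simp add: card_insert_if)
    fix x assume x: "x \<in> V" "x \<notin> Bn" "card (outside r x) < 680 * b"
    then have "A2 x \<inter> Y \<noteq> {}" using hitY by (simp add: W_def)
    then show "\<exists>y\<in>insert y0 (C \<inter> Y). \<exists>j\<in>S - B. j \<noteq> x \<and> \<not> E x j \<and> col x j = col r y \<and> j \<noteq> h y"
      by (auto simp: A2_def I_def)
  qed (use S y0 in auto)
qed


section \<open>The chain and its closure\<close>

text \<open>\<open>Z\<close> and \<open>D\<close> are the vertices and colours kept for the closure,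
  \<open>Bn\<close> the vertices for which it may fail. The colours from \<open>r\<close> to the set
  \<open>Q\<close> below are forbidden because they would force an occupied or protected vertex to
  become pending. Beyond the 4 |X| exclusions about 93 b are needed, and |V|/5 provides 200
  b.\<close>

lemma chain_step:
  assumes st: "partial_spider X g {p}" and FX: "F \<subseteq> X" and cX: "5 * (card X + 1) \<le> card V"
    and Z: "Z \<subseteq> V" "card Z \<le> 41 * b" "Z \<inter> (insert p X \<union> g ` X) = {}"
    and D: "finite D" "card D \<le> 11 * b" "D \<inter> cols X g = {}" and Bn: "Bn \<subseteq> V" "card Bn \<le> 20"
  shows "\<exists>j p'. partial_spider (insert p X) (g(p := j)) {p'} \<and> p' \<notin> Bn \<union> Z \<and> j \<notin> Z \<and> col p j \<notin> D"
proof -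
  note s = partial_spiderD[OF st]
  have pV: "p \<in> V" "p \<noteq> r" "p \<notin> X" using s(2,3) by auto
  have pF: "p \<notin> F" using FX pV by auto
  have pT: "p \<notin> T" using s(7) pF by auto
  have finZ: "finite Z" "finite Bn" using Z Bn finV finite_subset by blast+
  define B where "B = insert p X \<union> g ` X \<union> T \<union> Z"
  have finB: "finite B" using s finT finZ by (simp add: B_def)
  have cB: "card B \<le> 2 * card X + 1 + m + 41 * b"
  proof -
    have "card (insert p X) \<le> card X + 1" using s(12) by (simp add: card_insert_if)
    then show ?thesis
      using cT Z(2) card_image_le[OF s(12), of g] card_Un_le[of "insert p X \<union> g ` X \<union> T" Z]
        card_Un_le[of "insert p X \<union> g ` X" T] card_Un_le[of "insert p X" "g ` X"]
      unfolding B_def by linarith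
  qed
  define Q where "Q = (g ` X \<union> T \<union> Z \<union> Bn) - {r}"
  have finQ: "finite Q" using s finT finZ by (simp add: Q_def)
  have cQ: "card Q \<le> card X + m + 41 * b + 20"
  proof -
    have "card Q \<le> card (g ` X \<union> T \<union> Z \<union> Bn)"
      unfolding Q_def using s finT finZ by (intro card_mono) auto
    then show ?thesis
      using cT Z(2) Bn(2) card_image_le[OF s(12), of g] card_Un_le[of "g ` X \<union> T \<union> Z" Bn]
        card_Un_le[of "g ` X \<union> T" Z] card_Un_le[of "g ` X" T]
      by linarith
  qed
  define K where "K = cols X g \<union> col r ` Q \<union> D"
  have finK: "finite K" using finQ D s(12) finite_cols by (simp add: K_def)
  have cK: "card K \<le> 2 * card X + m + 52 * b + 20"
    using card_Un_le[of "cols X g \<union> col r ` Q" D] card_Un_le[of "cols X g" "col r ` Q"]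
      card_image_le[OF finQ, of "col r"] cQ D(2) card_cols_le[OF s(12), of g]
    unfolding K_def by linarith
  have "card V = Suc (card (V - {p}))" by (rule card.remove[OF finV pV(1)])
  moreover have "card B + card K + m \<le> 4 * card X + 3 * m + 93 * b + 21" using cB cK by linarith
  moreover have "5 * card X + 5 \<le> card V" using cX by simp
  ultimately have "card B + card K + m < card (V - {p})" using b1 b2 b3 m1 m2 by linarith
  from pick[OF pV(1) subset_refl finB finK this]
  obtain j where j: "j \<in> V" "j \<noteq> p" "j \<notin> B" "\<not> E p j" "col p j \<notin> K" by blast
  have jr: "j \<noteq> r" using j(3) rT by (auto simp: B_def)
  have key: "\<exists>y. y \<in> V - {r} \<and> y \<noteq> j \<and> y \<notin> insert p X \<union> g ` X \<union> T \<union> Z \<union> Bn \<and>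
     (\<forall>v\<in>V - {r} - insert p X - {y}. col p j \<noteq> col r v)"
  proof (cases "\<exists>y\<in>V - {r} - insert p X. col p j = col r y")
    case True
    then obtain y where y: "y \<in> V" "y \<noteq> r" "y \<notin> insert p X" "col p j = col r y" by auto
    have "y \<notin> Q" using y j(5) by (auto simp: K_def)
    moreover have "j \<noteq> y" by (rule col_link_neq[OF pV(1) j(1,2) jr pV(2) y(4)])
    moreover have "col p j \<noteq> col r v" if "v \<in> V - {r} - insert p X - {y}" for v
      using col_root_neq[of y v] that y by auto
    ultimately show ?thesis using y by (intro exI[of _ y]) (auto simp: Q_def)
  next
    \<comment> \<open>The colour is absent at \<open>r\<close> or has been freed before, so no
      vertex is forced out. An arbitrary one is detached, which keeps exactly one vertex
      pending.\<close>
    case False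
    have "card (insert j (B \<union> Bn)) \<le> card B + 20 + 1"
      using finB finZ Bn card_Un_le[of B Bn] by (simp add: card_insert_if)
    moreover have "5 * card X + 5 \<le> card V" using cX by simp
    then have "card B + 20 + 1 < card V" using cB b1 b2 b3 m1 m2 by linarith
    ultimately have "card (insert j (B \<union> Bn)) < card V" by linarith
    then have "\<not> V \<subseteq> insert j (B \<union> Bn)"
      using finB finZ card_mono[of "insert j (B \<union> Bn)" V] by auto
    then obtain y where "y \<in> V" "y \<notin> insert j (B \<union> Bn)" by blast
    then show ?thesis using False rT by (intro exI[of _ y]) (auto simp: B_def)
  qed
  then obtain y where y: "y \<in> V - {r}" "y \<noteq> j" "y \<notin> insert p X \<union> g ` X \<union> T \<union> Z \<union> Bn"
     and yc: "\<And>v. v \<in> V - {r} - insert p X - {y} \<Longrightarrow> col p j \<noteq> col r v" by blast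
  have st1: "partial_spider X g (insert y {p})" using y by (intro partial_spider_add[OF st]) auto
  have "partial_spider (insert p X) (g(p := j)) (insert y {p} - {p})"
  proof (rule partial_spider_match[OF st1])
    show "col p j \<noteq> col r v" if "v \<in> V - {r} - X - insert y {p}" for v
      using yc[of v] that by auto
  qed (use j y pF in \<open>auto simp: B_def K_def\<close>)
  moreover have "insert y {p} - {p} = {y}" using y by auto
  moreover have "y \<notin> Bn \<union> Z" "j \<notin> Z" "col p j \<notin> D" using y j by (auto simp: B_def K_def)
  ultimately show ?thesis by (intro exI[of _ j] exI[of _ y] conjI) simp_all
qed

lemma chain:
  assumes st: "partial_spider X0 g0 {p0}" and FX: "F \<subseteq> X0"
    and Z: "Z \<subseteq> V" "card Z \<le> 41 * b" "Z \<inter> (insert p0 X0 \<union> g0 ` X0) = {}"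
    and D: "finite D" "card D \<le> 11 * b" "D \<inter> cols X0 g0 = {}" and Bn: "Bn \<subseteq> V" "card Bn \<le> 20"
    and k: "5 * (card X0 + Suc k) \<le> card V"
  shows "\<exists>X g p. partial_spider X g {p} \<and> insert p0 X0 \<subseteq> X \<and> card X = card X0 + Suc k \<and> p \<notin> Bn \<and>
     Z \<inter> (insert p X \<union> g ` X) = {} \<and> D \<inter> cols X g = {}"
proof -
  have step: "\<exists>X' g' p'. partial_spider X' g' {p'} \<and> insert p X \<subseteq> X' \<and> card X' = Suc (card X) \<and> p' \<notin> Bn \<and>
     Z \<inter> (insert p' X' \<union> g' ` X') = {} \<and> D \<inter> cols X' g' = {}"
    if X: "partial_spider X g {p}" "F \<subseteq> X" "5 * (card X + 1) \<le> card V"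
      "Z \<inter> (insert p X \<union> g ` X) = {}" "D \<inter> cols X g = {}" for X g p
  proof -
    have pX: "p \<notin> X" "finite X" using partial_spiderD(3,12)[OF X(1)] by auto
    obtain j p' where j: "partial_spider (insert p X) (g(p := j)) {p'}" "p' \<notin> Bn \<union> Z" "j \<notin> Z" "col p j \<notin> D"
      using chain_step[OF X(1,2,3) Z(1,2) X(4) D(1,2) X(5) Bn] by blast
    have "Z \<inter> (insert p' (insert p X) \<union> (g(p := j)) ` insert p X) = {}"
      unfolding image_fun_upd_insert[OF pX(1)] using j X(4) by auto
    moreover have "D \<inter> cols (insert p X) (g(p := j)) = {}"
      unfolding cols_upd[OF pX(1)] using j X(5) by auto
    ultimately show ?thesis using j pX
      by (intro exI[of _ "insert p X"] exI[of _ "g(p := j)"] exI[of _ p']) auto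
  qed
  show ?thesis using k
  proof (induction k)
    case 0
    then show ?case using step[OF st FX _ Z(3) D(3)] by simp
  next
    case (Suc k)
    then obtain X g p where X: "partial_spider X g {p}" "insert p0 X0 \<subseteq> X" "card X = card X0 + Suc k"
       "Z \<inter> (insert p X \<union> g ` X) = {}" "D \<inter> cols X g = {}" by auto
    have "\<exists>X' g' p'. partial_spider X' g' {p'} \<and> insert p X \<subseteq> X' \<and> card X' = Suc (card X) \<and> p' \<notin> Bn \<and>
       Z \<inter> (insert p' X' \<union> g' ` X') = {} \<and> D \<inter> cols X' g' = {}"
    proof (rule step[OF X(1) _ _ X(4,5)])
      show "F \<subseteq> X" using X(2) FX by blast
      show "5 * (card X + 1) \<le> card V" using X(3) Suc.prems by simp
    qed
    then obtain X' g' p' where X': "partial_spider X' g' {p'}" "insert p X \<subseteq> X'" "card X' = Suc (card X)" "p' \<notin> Bn"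
       "Z \<inter> (insert p' X' \<union> g' ` X') = {}" "D \<inter> cols X' g' = {}" by blast
    show ?case
    proof (intro exI[of _ X'] exI[of _ g'] exI[of _ p'] conjI)
      show "insert p0 X0 \<subseteq> X'" using X(2) X'(2) by blast
      show "card X' = card X0 + Suc (Suc k)" using X(3) X'(3) by simp
    qed (fact X')+
  qed
qed

text \<open>Unlike in \<open>chain_step\<close>, the leg of the vertex \<open>y\<close> forced out
  by \<open>p\<close> is known in advance, so nothing stays pending.\<close>

lemma close:
  assumes st: "partial_spider X g {p}" and pF: "p \<notin> F"
    and y: "y \<in> V" "y \<notin> insert p X \<union> g ` X \<union> T"
    and hy: "hy \<in> V" "hy \<noteq> y" "hy \<notin> insert p X \<union> g ` X \<union> T" "\<not> E y hy" "col y hy \<notin> cols X g"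
      "\<And>v. v \<in> V - {r} - X \<Longrightarrow> col y hy \<noteq> col r v"
    and j: "j \<in> V" "j \<noteq> p" "j \<noteq> y" "j \<noteq> hy" "j \<notin> X \<union> g ` X \<union> T" "\<not> E p j" "col p j \<notin> cols X g"
      "col p j \<noteq> col y hy" "col p j = col r y \<or> col p j \<notin> star_cols r"
  shows "\<exists>X' g'. partial_spider X' g' {} \<and> X \<subseteq> X' \<and> card X' = card X + 2"
proof -
  note s = partial_spiderD[OF st]
  have pX: "p \<notin> X" and yr: "y \<noteq> r" using s(3) y rT by auto
  have st1: "partial_spider X g (insert y {p})" using y by (intro partial_spider_add[OF st]) auto
  have st2: "partial_spider (insert p X) (g(p := j)) (insert y {p} - {p})"
  proof (rule partial_spider_match[OF st1])
    show "col p j \<noteq> col r v" if "v \<in> V - {r} - X - insert y {p}" for v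
      using j(9) col_root_neq[of y v] that y yr by (auto simp: star_cols_def)
  qed (use j pF in auto)
  have c2: "cols (insert p X) (g(p := j)) = insert (col p j) (cols X g)" by (rule cols_upd[OF pX])
  have i2: "(g(p := j)) ` insert p X = insert j (g ` X)" by (rule image_fun_upd_insert[OF pX])
  have "partial_spider (insert y (insert p X)) (g(p := j, y := hy)) (insert y {p} - {p} - {y})"
  proof (rule partial_spider_match[OF st2])
    show "hy \<notin> (g(p := j)) ` insert p X" unfolding i2 using j hy by auto
    show "col y hy \<notin> cols (insert p X) (g(p := j))" unfolding c2 using j hy by auto
    show "y \<in> F \<Longrightarrow> hy \<in> A y" using y FT by auto
  qed (use hy y in auto)
  moreover have "insert y {p} - {p} - {y} = {}" by auto
  moreover have "card (insert y (insert p X)) = card X + 2" using y pX s(12) by simp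
  ultimately show ?thesis
    by (intro exI[of _ "insert y (insert p X)"] exI[of _ "g(p := j, y := hy)"]) auto
qed

text \<open>The legs of the earlier roots come first, then a closing reserve is built around the
  colour of a suitable r--x1, and the chain starts with x1. The reserve is fixed before the chain,
  since the last pending vertex cannot be foreseen.\<close>

lemma finish:
  assumes st0: "partial_spider X0 g0 {}" and FX: "F \<subseteq> X0" and cX0: "card X0 \<le> 4 * m"
    and t: "700 * m \<le> t" "5 * t \<le> card V"
  shows "\<exists>X g. partial_spider X g {} \<and> F \<subseteq> X \<and> card X = t"
proof -
  note s0 = partial_spiderD[OF st0]
  define B0 where "B0 = X0 \<union> g0 ` X0 \<union> T"
  have finB0: "finite B0" and B0V: "B0 \<subseteq> V" using s0 finT TV by (auto simp: B0_def)
  have cB0: "card B0 \<le> 9 * m"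
    using cX0 cT card_image_le[OF s0(12), of g0] card_Un_le[of "X0 \<union> g0 ` X0" T] card_Un_le[of X0 "g0 ` X0"]
    unfolding B0_def by linarith
  have "card B0 < b" using cB0 m1 m2 by linarith
  from start_vertex[OF finB0 this] obtain x1 where x1: "x1 \<in> V" "x1 \<noteq> r" "x1 \<notin> B0"
    and x1b: "card {y \<in> V - {r} - rich r. \<not> has_col y (col r x1)} \<le> b"
    by blast
  define B1 where "B1 = insert x1 B0"
  define q where "q = col r x1"
  have finB1: "finite B1" and B1V: "B1 \<subseteq> V" using finB0 B0V x1 by (auto simp: B1_def)
  have cB1: "card B1 \<le> 10 * m" using cB0 finB0 m1 by (simp add: B1_def card_insert_if)
  define Zs where "Zs = {y \<in> V - {r}. y \<in> rich r \<or> has_col y q} - B1"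
  have cZs: "card V \<le> card Zs + b + 10 * m + 1"
  proof -
    have "V = Zs \<union> ({y \<in> V - {r} - rich r. \<not> has_col y (col r x1)} \<union> (insert r B1))"
      using rV B1V by (auto simp: Zs_def q_def)
    then have "card V \<le> card Zs + card ({y \<in> V - {r} - rich r. \<not> has_col y (col r x1)} \<union> (insert r B1))"
      by (metis card_Un_le)
    also have "\<dots> \<le> card Zs + (b + card (insert r B1))"
      using x1b card_Un_le[of "{y \<in> V - {r} - rich r. \<not> has_col y (col r x1)}" "insert r B1"] by linarith
    also have "card (insert r B1) \<le> 10 * m + 1" using finB1 cB1 by (simp add: card_insert_if)
    finally show ?thesis by simp
  qed
  have finK: "finite (cols X0 g0)" "card (cols X0 g0) \<le> 4 * m"
    using finite_cols[OF s0(12), of g0] card_cols_le[OF s0(12), of g0] cX0 by simp_all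
  have qK: "q \<notin> cols X0 g0"
  proof
    assume "q \<in> cols X0 g0"
    then obtain x where "x \<in> X0" "col x (g0 x) = col r x1" by (auto simp: cols_def q_def)
    then show False using s0(10)[of x x1] x1 by (auto simp: B0_def)
  qed
  obtain C h where C: "C \<subseteq> Zs" "card Zs \<le> card C + 12 * m"
    and h: "\<And>z. z \<in> C \<Longrightarrow> h z \<in> V \<and> h z \<noteq> z \<and> h z \<notin> B1 \<and> \<not> E z (h z) \<and> col z (h z) \<notin> cols X0 g0
        \<and> (col z (h z) = q \<or> col z (h z) \<notin> star_cols r)"
  proof (rule closers[OF finB1 B1V cB1 finK qK, of Zs])
    show "Zs \<subseteq> V" by (auto simp: Zs_def)
    show "\<And>z. z \<in> Zs \<Longrightarrow> z \<in> rich r \<or> has_col z q" by (auto simp: Zs_def)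
  qed (rule that)
  have C': "C \<subseteq> V - {r}" "card V \<le> card C + 4 * b" using C cZs m1 m2 b3 by (auto simp: Zs_def)
  have hV: "\<And>y. y \<in> C \<Longrightarrow> h y \<in> V" using h by blast
  obtain Bn R Y where Bn: "Bn \<subseteq> V" "card Bn \<le> 20" and R: "R \<subseteq> V - B1" "card R \<le> 20 * b"
    and Y: "Y \<subseteq> C" "Y \<noteq> {}" "card Y \<le> 10 * b + 1"
    and RY: "\<And>x. x \<in> V \<Longrightarrow> x \<notin> Bn \<Longrightarrow> card (outside r x) < 680 * b \<Longrightarrow>
       \<exists>y\<in>Y. \<exists>j\<in>R. j \<noteq> x \<and> \<not> E x j \<and> col x j = col r y \<and> j \<noteq> h y"
    by (rule reserve[where h = h, OF C'(1) C'(2) hV finB1 cB1]) (blast, rule that)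
  have finY: "finite Y" "finite R"
    using finite_subset[of Y V] finite_subset[of R V] Y(1) C'(1) R(1) finV by auto
  define Z where "Z = Y \<union> h ` Y \<union> R"
  \<comment> \<open>The chain must not use these colours; one of them may be \<open>q\<close>, which
    is freed as soon as x1 is detached.\<close>
  define D where "D = (\<lambda>y. col y (h y)) ` Y"
  have YB1: "Y \<inter> B1 = {}" using Y C by (auto simp: Zs_def)
  have ZV: "Z \<subseteq> V" and ZB: "Z \<inter> B1 = {}" using Y C' R h YB1 by (auto simp: Z_def)
  have cZ: "card Z \<le> 41 * b"
    using card_Un_le[of "Y \<union> h ` Y" R] card_Un_le[of Y "h ` Y"] card_image_le[OF finY(1), of h] Y(3) R(2) b3
    unfolding Z_def by linarith
  have finZ: "finite Z" using ZV finV finite_subset by blast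
  have D: "finite D" "card D \<le> 11 * b" "D \<inter> cols X0 g0 = {}"
    using finY card_image_le[OF finY(1), of "\<lambda>y. col y (h y)"] Y b3 h by (auto simp: D_def)
  have st1: "partial_spider X0 g0 {x1}" using x1 by (intro partial_spider_add[OF st0]) (auto simp: B0_def)
  \<comment> \<open>The chain makes \<open>Suc k\<close> steps and has to stop with t - 2 legs, as
    \<open>close\<close> adds those of the last pending vertex and of y.\<close>
  define k where "k = t - 3 - card X0"
  have k: "card X0 + Suc k + 2 = t" using t(1) cX0 m1 by (simp add: k_def)
  obtain X g p where st: "partial_spider X g {p}" and X: "insert x1 X0 \<subseteq> X" "card X = card X0 + Suc k" "p \<notin> Bn"
     and ZX: "Z \<inter> (insert p X \<union> g ` X) = {}" and DX: "D \<inter> cols X g = {}"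
  proof -
    have "Z \<inter> (insert x1 X0 \<union> g0 ` X0) = {}" using ZB by (auto simp: B1_def B0_def)
    moreover have "5 * (card X0 + Suc k) \<le> card V" using k t(2) by simp
    ultimately show ?thesis using chain[OF st1 FX ZV cZ _ D Bn] that by metis
  qed
  note s = partial_spiderD[OF st]
  have pV: "p \<in> V" "p \<notin> X" using s(2,3) by auto
  have pF: "p \<notin> F" using pV FX X by auto
  have TZ: "T \<inter> Z = {}" using ZB by (auto simp: B1_def B0_def)
  have hX: "col y (h y) \<notin> cols X g" "\<And>v. v \<in> V - {r} - X \<Longrightarrow> col y (h y) \<noteq> col r v"
    "col y (h y) \<noteq> col r y" if y: "y \<in> Y" for y
  proof -
    show "col y (h y) \<notin> cols X g" using y DX by (auto simp: D_def)
    \<comment> \<open>The closing edge has the colour \<open>q\<close>, which occurs at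
      \<open>r\<close> only on the edge to x1, or a colour absent at \<open>r\<close>.\<close>
    have neq: "col y (h y) \<noteq> col r v" if "v \<in> V - {r}" "v \<noteq> x1" for v
      using h[of y] y Y that x1 col_root_neq[of x1 v] by (auto simp: q_def star_cols_def)
    show "\<And>v. v \<in> V - {r} - X \<Longrightarrow> col y (h y) \<noteq> col r v" using neq X by auto
    show "col y (h y) \<noteq> col r y" using neq[of y] y YB1 Y C' by (auto simp: B1_def)
  qed
  have main: "\<exists>X' g'. partial_spider X' g' {} \<and> X \<subseteq> X' \<and> card X' = card X + 2"
    if y: "y \<in> Y" and j: "j \<in> V" "j \<noteq> p" "j \<noteq> y" "j \<noteq> h y" "j \<notin> X \<union> g ` X \<union> T" "\<not> E p j" "col p j \<notin> cols X g"
      "col p j \<noteq> col y (h y)" "col p j = col r y \<or> col p j \<notin> star_cols r" for y j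
  proof (rule close[OF st pF _ _ _ _ _ _ _ _ j])
    have yZ: "y \<in> Z" "h y \<in> Z" using y by (auto simp: Z_def)
    show "y \<in> V" "h y \<in> V" using yZ ZV by auto
    show "y \<notin> insert p X \<union> g ` X \<union> T" "h y \<notin> insert p X \<union> g ` X \<union> T" using yZ ZX TZ by auto
    show "h y \<noteq> y" "\<not> E y (h y)" using h[of y] y Y by auto
    show "col y (h y) \<notin> cols X g" by (rule hX(1)[OF y])
    show "\<And>v. v \<in> V - {r} - X \<Longrightarrow> col y (h y) \<noteq> col r v" by (rule hX(2)[OF y])
  qed
  have "\<exists>X' g'. partial_spider X' g' {} \<and> X \<subseteq> X' \<and> card X' = card X + 2"
  proof (cases "card (outside r p) < 680 * b")
    case True
    obtain y j where yj: "y \<in> Y" "j \<in> R" "j \<noteq> p" "\<not> E p j" "col p j = col r y" "j \<noteq> h y"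
      using RY[OF pV(1) X(3) True] by blast
    have jZ: "j \<in> Z" and yZ: "y \<in> Z" using yj by (auto simp: Z_def)
    have yV: "y \<in> V" "y \<noteq> r" "y \<notin> insert p X" using yj Y C' yZ ZX by auto
    show ?thesis
    proof (rule main[OF yj(1)])
      show "j \<in> V" using jZ ZV by auto
      show "j \<noteq> y"
      proof (rule col_link_neq[OF pV(1) \<open>j \<in> V\<close> yj(3) _ _ yj(5)])
        show "j \<noteq> r" using jZ TZ rT by auto
        show "p \<noteq> r" using s(2) by auto
      qed
      show "j \<notin> X \<union> g ` X \<union> T" using jZ ZX TZ by auto
      show "col p j \<notin> cols X g"
      proof
        assume "col p j \<in> cols X g"
        then obtain x where "x \<in> X" "col x (g x) = col r y" using yj(5) by (auto simp: cols_def)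
        then show False using s(10)[of x y] yV by auto
      qed
      show "col p j \<noteq> col y (h y)" using hX(3)[OF yj(1)] yj(5) by simp
    qed (use yj in auto)
  next
    case False
    \<comment> \<open>At most 3 t + 52 b + 2 m choices are blocked, and 3 t is at most 600.6 b. This
      is the reason for the threshold 680 b.\<close>
    define B where "B = X \<union> g ` X \<union> T \<union> Z"
    have finB: "finite B" using s finT finZ by (simp add: B_def)
    have cB: "card B \<le> 2 * t + m + 41 * b"
      using cT cZ card_image_le[OF s(12), of g] card_Un_le[of "X \<union> g ` X \<union> T" Z]
        card_Un_le[of "X \<union> g ` X" T] card_Un_le[of X "g ` X"] X(2) k
      unfolding B_def by linarith
    have cK: "card (cols X g \<union> D) \<le> t + 11 * b"
      using card_Un_le[of "cols X g" D] card_cols_le[OF s(12), of g] D(2) X(2) k by linarith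
    have finK': "finite (cols X g \<union> D)" using finite_cols[OF s(12)] D by simp
    have "card B + card (cols X g \<union> D) + m < card (outside r p)"
      using False cB cK t(2) b2 b3 m1 m2 by linarith
    from pick[OF pV(1) outside_subset finB finK' this]
    obtain j where j: "j \<in> outside r p" "j \<notin> B" "\<not> E p j" "col p j \<notin> cols X g \<union> D" by blast
    obtain y where y: "y \<in> Y" using Y by blast
    show ?thesis
      by (rule main[OF y, of j]) (use j y in \<open>auto simp: outside_def B_def Z_def D_def\<close>)
  qed
  then obtain X' g' where X': "partial_spider X' g' {}" "X \<subseteq> X'" "card X' = card X + 2" by blast
  then show ?thesis using X(1,2) k FX by (intro exI[of _ X'] exI[of _ g']) auto
qed

lemma spider_exists:
  assumes XO: "partial_spider XO gO F" "card XO \<le> m"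
    and uu: "50 * b \<le> card (rich r) \<or>
     inj_on uu F \<and> (\<forall>f\<in>F. popular (col r (uu f)) \<and> uu f \<in> XO \<union> F \<and> col r (uu f) \<notin> cols XO gO)"
    and t: "700 * m \<le> t" "5 * t \<le> card V"
  shows "\<exists>X g. partial_spider X g {} \<and> F \<subseteq> X \<and> card X = t"
proof -
  have "card XO + 3 * card F \<le> 4 * m" using XO(2) card_F by linarith
  from forced[OF XO(1) subset_refl this uu]
  obtain X g where "partial_spider X g {}" "F \<subseteq> X" "card X \<le> 4 * m" by blast
  then show ?thesis using finish t by blast
qed

end

section \<open>Choosing the roots\<close>

text \<open>Both orientations of every leg, so that edge-disjointness becomes disjointness of sets
  of pairs.\<close>

definition arcs :: "'a set \<Rightarrow> ('a \<Rightarrow> 'a) \<Rightarrow> ('a \<times> 'a) set" where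
  "arcs X g = (\<lambda>x. (x, g x)) ` X \<union> (\<lambda>x. (g x, x)) ` X"

lemma arcs_sym: "(u, v) \<in> arcs X g \<Longrightarrow> (v, u) \<in> arcs X g"
  by (auto simp: arcs_def)

lemma card_arcs_le: "finite X \<Longrightarrow> card (arcs X g) \<le> 2 * card X"
  using card_Un_le[of "(\<lambda>x. (x, g x)) ` X" "(\<lambda>x. (g x, x)) ` X"]
    card_image_le[of X "\<lambda>x. (x, g x)"] card_image_le[of X "\<lambda>x. (g x, x)"]
  unfolding arcs_def by linarith

lemma arcs_disjointI:
  assumes "\<And>x. x \<in> X \<Longrightarrow> (x, g x) \<notin> arcs Y h"
  shows "arcs X g \<inter> arcs Y h = {}"
  using assms arcs_sym[of _ _ Y h] unfolding arcs_def[of X g] by blast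

context big_clique begin

definition unpopular :: "'a \<Rightarrow> 'a set" where
  "unpopular r = {f \<in> V - {r}. \<not> popular (col r f)}"

text \<open>Candidates for reserved edges: x is to be detached and re-attached to j in a colour
  absent at \<open>r\<close>. As rich x are left out, each x contributes fewer than b/10 pairs, so
  that few pairs start at an unpopular x.\<close>

definition free_pairs :: "'a \<Rightarrow> ('a \<times> 'a) set" where
  "free_pairs r = Sigma (V - {r} - rich r) (outside r)"

lemma finite_free_pairs: "finite (free_pairs r)"
  unfolding free_pairs_def using finV by (intro finite_SigmaI) auto

lemma finite_unpopular: "finite (unpopular r)"
  unfolding unpopular_def using finV by auto

text \<open>An unpopular colour is seen by fewer than 100 b of the at least 949 b vertices that are
  not rich. By \<open>card_outside\<close>, counting missing colours of \<open>r\<close> is the same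
  as counting free pairs.\<close>

lemma card_free_pairs:
  assumes r: "r \<in> V" and poor: "card (rich r) < 50 * b"
  shows "849 * b * card (unpopular r) \<le> card (free_pairs r)"
proof -
  define L where "L = V - {r} - rich r"
  have finL: "finite L" using finV by (simp add: L_def)
  have cL: "949 * b \<le> card L"
  proof -
    have "card V - card (insert r (rich r)) \<le> card (V - insert r (rich r))"
      using finV by (intro diff_card_le_card_Diff) (simp add: rich_def)
    moreover have "V - insert r (rich r) = L" by (auto simp: L_def)
    moreover have "card (insert r (rich r)) \<le> Suc (card (rich r))"
      using finV by (simp add: card_insert_if rich_def)
    ultimately show ?thesis using b1 b3 poor by simp
  qed
  have "849 * b * card (unpopular r) = (\<Sum>u\<in>unpopular r. 849 * b)" by simp
  also have "\<dots> \<le> (\<Sum>u\<in>unpopular r. card {x \<in> L. \<not> has_col x (col r u)})"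
  proof (rule sum_mono)
    fix u assume u: "u \<in> unpopular r"
    have "card {x \<in> L. has_col x (col r u)} \<le> card {x \<in> V. has_col x (col r u)}"
      using finV by (intro card_mono) (auto simp: L_def)
    moreover have "\<dots> < 100 * b" using u by (auto simp: unpopular_def popular_def)
    moreover have "card L = card {x \<in> L. has_col x (col r u)} + card {x \<in> L. \<not> has_col x (col r u)}"
      by (rule card_filter_split[OF finL])
    ultimately show "849 * b \<le> card {x \<in> L. \<not> has_col x (col r u)}" using cL by linarith
  qed
  also have "\<dots> \<le> (\<Sum>u\<in>V - {r}. card {x \<in> L. \<not> has_col x (col r u)})"
    using finV by (intro sum_mono2) (auto simp: unpopular_def)
  also have "\<dots> = (\<Sum>x\<in>L. card (outside r x))"
    by (rule sum_multicount_gen) (auto simp: finV L_def card_outside[OF r])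
  also have "\<dots> = card (free_pairs r)"
    unfolding free_pairs_def L_def[symmetric] using finL by (simp add: card_SigmaI)
  finally show ?thesis .
qed

text \<open>The leg at x uses no colour of \<open>r\<close>, so the popular colour of r--x is freed
  without being consumed. It will stand in for the unpopular colour of an earlier root.\<close>

definition reserved :: "'a set \<Rightarrow> 'a \<Rightarrow> 'a set \<Rightarrow> ('a \<Rightarrow> 'a) \<Rightarrow> bool" where
  "reserved T r X g \<longleftrightarrow> X \<subseteq> V - T \<and> g ` X \<subseteq> V - T \<and> X \<inter> g ` X = {} \<and> inj_on g X \<and>
     inj_on (\<lambda>x. col x (g x)) X \<and> (\<forall>x\<in>X. g x \<in> outside r x \<and> popular (col r x))"

text \<open>The fraction 1/8 limits the number of reservations, 1/4 the candidates lost to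
  \<open>T\<close>; both are tuned to the count in \<open>reserved_exists\<close>. With 50 b rich
  vertices or more, \<open>link\<close> relies on absent colours instead.\<close>

definition sparse_roots :: "'a set \<Rightarrow> bool" where
  "sparse_roots T \<longleftrightarrow> T \<subseteq> V \<and> card T = m \<and> (\<forall>r\<in>T. card (rich r) < 50 * b \<longrightarrow>
     8 * card (unpopular r \<inter> T) \<le> card (unpopular r) \<and>
     4 * card {e \<in> free_pairs r. fst e \<in> T \<or> snd e \<in> T} \<le> card (free_pairs r))"

text \<open>One weight on ordered pairs encodes both conditions: weight at most 1 inside
  \<open>T\<close> bounds each of its two summands. A row sums to at most 8 + 8, since each free
  pair touches two vertices.\<close>

lemma sparse_roots_exist: "\<exists>T. sparse_roots T"
proof -
  define tch where "tch r v = card {e \<in> free_pairs r. fst e = v \<or> snd e = v}" for r v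
  \<comment> \<open>If there are no unpopular vertices or no free pairs, division by zero gives the
    value 0 wanted here.\<close>
  define w :: "'a \<Rightarrow> 'a \<Rightarrow> real" where
    "w r v = (if card (rich r) < 50 * b then 8 * (if v \<in> unpopular r then 1 else 0) / card (unpopular r)
       + 4 * tch r v / card (free_pairs r) else 0)" for r v
  have w0: "0 \<le> w r v" for r v by (simp add: w_def)
  have wr: "w r r = 0" for r
  proof -
    have "{e \<in> free_pairs r. fst e = r \<or> snd e = r} = {}"
      by (auto simp: free_pairs_def outside_def star_cols_def col_sym[of _ r])
    then have "tch r r = 0" unfolding tch_def by (simp only: card.empty)
    then show ?thesis by (simp add: w_def unpopular_def)
  qed
  have tchsum: "(\<Sum>v\<in>V. tch r v) \<le> 2 * card (free_pairs r)" for r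
  proof -
    have "(\<Sum>v\<in>V. tch r v) = (\<Sum>e\<in>free_pairs r. card {v \<in> V. fst e = v \<or> snd e = v})"
      unfolding tch_def by (rule sum_multicount_gen) (auto simp: finV finite_free_pairs)
    also have "\<dots> \<le> (\<Sum>e\<in>free_pairs r. 2)"
    proof (rule sum_mono)
      fix e :: "'a \<times> 'a"
      have "card {v \<in> V. fst e = v \<or> snd e = v} \<le> card {fst e, snd e}" by (rule card_mono) auto
      also have "\<dots> \<le> 2" by (simp add: card_insert_if)
      finally show "card {v \<in> V. fst e = v \<or> snd e = v} \<le> 2" .
    qed
    finally show ?thesis by simp
  qed
  have row: "(\<Sum>v\<in>V. w r v) \<le> 16" for r
  proof (cases "card (rich r) < 50 * b")
    case True
    have "(\<Sum>v\<in>V. if v \<in> unpopular r then (1::real) else 0) = card (unpopular r)"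
      using sum.inter_restrict[OF finV, of "\<lambda>_. 1::real" "unpopular r"] by (simp add: unpopular_def Int_def)
    then have "(\<Sum>v\<in>V. w r v) = 8 * card (unpopular r) / card (unpopular r) + 4 * (\<Sum>v\<in>V. tch r v) / card (free_pairs r)"
      using True by (simp add: w_def sum.distrib flip: sum_divide_distrib sum_distrib_left)
    moreover have "8 * card (unpopular r) / card (unpopular r) \<le> (8::real)" by simp
    moreover have "4 * (\<Sum>v\<in>V. tch r v) / card (free_pairs r) \<le> (8::real)"
    proof (cases "card (free_pairs r) = 0")
      case False
      have "real (\<Sum>v\<in>V. tch r v) \<le> real (2 * card (free_pairs r))"
        using tchsum[of r] by (simp only: of_nat_le_iff)
      then show ?thesis using False by (simp add: divide_le_eq)
    qed simp
    ultimately show ?thesis by linarith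
  qed (simp add: w_def)
  have "64 * m \<le> card V" using b1 m2 by linarith
  from sparse_subset[OF finV w0 row this wr]
  obtain T where T: "T \<subseteq> V" "card T = m" "\<And>r. r \<in> T \<Longrightarrow> (\<Sum>v\<in>T. w r v) \<le> 1" by blast
  have finT: "finite T" using T finV finite_subset by blast
  have "8 * card (unpopular r \<inter> T) \<le> card (unpopular r) \<and>
     4 * card {e \<in> free_pairs r. fst e \<in> T \<or> snd e \<in> T} \<le> card (free_pairs r)"
    if r: "r \<in> T" and poor: "card (rich r) < 50 * b" for r
  proof -
    have "(\<Sum>v\<in>T. if v \<in> unpopular r then (1::real) else 0) = card (unpopular r \<inter> T)"
      using sum.inter_restrict[OF finT, of "\<lambda>_. 1::real" "unpopular r"] by (simp add: Int_commute)
    then have eq: "(\<Sum>v\<in>T. w r v) = 8 * card (unpopular r \<inter> T) / card (unpopular r) + 4 * (\<Sum>v\<in>T. tch r v) / card (free_pairs r)"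
      using poor by (simp add: w_def sum.distrib flip: sum_divide_distrib sum_distrib_left)
    have p: "0 \<le> 8 * real (card (unpopular r \<inter> T)) / card (unpopular r)" "0 \<le> 4 * real (\<Sum>v\<in>T. tch r v) / card (free_pairs r)"
      by (simp_all add: sum_nonneg)
    have 1: "8 * real (card (unpopular r \<inter> T)) / card (unpopular r) \<le> 1" "4 * real (\<Sum>v\<in>T. tch r v) / card (free_pairs r) \<le> 1"
      using T(3)[OF r] eq p by linarith+
    have "8 * card (unpopular r \<inter> T) \<le> card (unpopular r)"
    proof (cases "unpopular r = {}")
      case False
      then have "0 < card (unpopular r)" using finite_unpopular by (simp add: card_gt_0_iff)
      then show ?thesis using 1(1) by (simp add: divide_le_eq flip: of_nat_le_iff[where 'a=real])
    qed simp
    moreover have "4 * card {e \<in> free_pairs r. fst e \<in> T \<or> snd e \<in> T} \<le> card (free_pairs r)"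
    proof (cases "free_pairs r = {}")
      case False
      then have "0 < card (free_pairs r)" using finite_free_pairs by (simp add: card_gt_0_iff)
      then have "real (4 * (\<Sum>v\<in>T. tch r v)) \<le> real (card (free_pairs r))"
        using 1(2) by (simp add: divide_le_eq)
      then have "4 * (\<Sum>v\<in>T. tch r v) \<le> card (free_pairs r)" by (simp only: of_nat_le_iff)
      moreover have "card {e \<in> free_pairs r. fst e \<in> T \<or> snd e \<in> T} \<le> (\<Sum>v\<in>T. tch r v)"
      proof -
        have "{e \<in> free_pairs r. fst e \<in> T \<or> snd e \<in> T} = (\<Union>v\<in>T. {e \<in> free_pairs r. fst e = v \<or> snd e = v})"
          by auto
        then show ?thesis by (simp only: tch_def card_UN_le[OF finT])
      qed
      ultimately show ?thesis by linarith
    qed simp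
    ultimately show ?thesis by blast
  qed
  then show ?thesis using T unfolding sparse_roots_def by blast
qed

section \<open>Reserved edges for the rare colours\<close>

text \<open>Greedy choice among at least 849 \<rho> free pairs, where \<rho> is \<open>b\<close>
  times the number of unpopular vertices. At most a quarter touches \<open>T\<close>. The k earlier
  edges exclude at most 5 k n pairs, and k is at most an eighth of the number of unpopular vertices.
  Since 3/4 * 849 > 636 and 5/8 * 1001 < 626, a pair is left even after removing the fewer than
  \<rho> pairs in \<open>N2\<close> and \<open>Q\<close>.\<close>

lemma reserved_exists:
  assumes T: "sparse_roots T" and r: "r \<in> T" and poor: "card (rich r) < 50 * b"
    and Q: "finite Q" "4 * card Q \<le> m * card (unpopular r)"
  shows "\<exists>X g. reserved T r X g \<and> card X = card (unpopular r \<inter> T) \<and> (\<forall>x\<in>X. (x, g x) \<notin> Q)"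
proof -
  have TV: "T \<subseteq> V" and rV: "r \<in> V" and s8: "8 * card (unpopular r \<inter> T) \<le> card (unpopular r)"
    and s4: "4 * card {e \<in> free_pairs r. fst e \<in> T \<or> snd e \<in> T} \<le> card (free_pairs r)"
    using T r poor by (auto simp: sparse_roots_def)
  have low: "849 * b * card (unpopular r) \<le> card (free_pairs r)" by (rule card_free_pairs[OF rV poor])
  have cV: "card V \<le> 1001 * b" by (rule b2)
  have "k \<le> card (unpopular r \<inter> T) \<Longrightarrow> \<exists>X g. reserved T r X g \<and> card X = k \<and> (\<forall>x\<in>X. (x, g x) \<notin> Q)" for k
  proof (induction k)
    case 0
    show ?case by (intro exI[of _ "{}"]) (simp add: reserved_def)
  next
    case (Suc k)
    then obtain X g where X: "reserved T r X g" "card X = k" "\<forall>x\<in>X. (x, g x) \<notin> Q" by auto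
    have finX: "finite X" using X(1) finV by (auto simp: reserved_def intro: finite_subset)
    define H where "H = free_pairs r"
    have finH: "finite H" by (simp add: H_def finite_free_pairs)
    have HV: "fst e \<in> V" "snd e \<in> V" "fst e \<noteq> snd e" "fst e \<noteq> r" if "e \<in> H" for e
      using that by (auto simp: H_def free_pairs_def outside_def)
    define U where "U = X \<union> g ` X"
    have finU: "finite U" and cU: "card U \<le> 2 * k"
      using finX X(2) card_Un_le[of X "g ` X"] card_image_le[OF finX, of g] by (auto simp: U_def)
    define N1 where "N1 = {e \<in> H. fst e \<in> T \<or> snd e \<in> T}"
    define N2 where "N2 = {e \<in> H. fst e \<in> unpopular r}"
    define N3 where "N3 = {e \<in> H. fst e \<in> U}"
    define N4 where "N4 = {e \<in> H. snd e \<in> U}"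
    define N5 where "N5 = {e \<in> H. \<exists>x\<in>X. col (fst e) (snd e) = col x (g x)}"
    have n1: "4 * card N1 \<le> card H" using s4 by (simp add: N1_def H_def)
    have n2: "10 * card N2 \<le> card (unpopular r) * b"
    proof -
      have "N2 = Sigma (unpopular r - rich r) (outside r)"
        by (auto simp: N2_def H_def free_pairs_def unpopular_def)
      then have "card N2 = (\<Sum>x\<in>unpopular r - rich r. card (outside r x))"
        using finite_unpopular by (simp add: card_SigmaI)
      then have "10 * card N2 = (\<Sum>x\<in>unpopular r - rich r. 10 * card (outside r x))"
        by (simp add: sum_distrib_left)
      also have "\<dots> \<le> (\<Sum>x\<in>unpopular r - rich r. b)"
        by (intro sum_mono) (auto simp: rich_def unpopular_def)
      also have "\<dots> \<le> card (unpopular r) * b" using finite_unpopular by (auto intro!: card_mono)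
      finally show ?thesis .
    qed
    have n3: "card N3 \<le> 2 * k * card V"
    proof -
      have "card N3 \<le> card (U \<times> V)" using HV finU finV by (intro card_mono) (auto simp: N3_def mem_Times_iff)
      also have "\<dots> = card U * card V" by (rule card_cartesian_product)
      finally show ?thesis using cU by (meson le_trans mult_le_mono1)
    qed
    have n4: "card N4 \<le> 2 * k * card V"
    proof -
      have "card N4 \<le> card (V \<times> U)" using HV finU finV by (intro card_mono) (auto simp: N4_def mem_Times_iff)
      also have "\<dots> = card U * card V" by (simp add: card_cartesian_product)
      finally show ?thesis using cU by (meson le_trans mult_le_mono1)
    qed
    have n5: "card N5 \<le> k * card V"
    proof -
      define S where "S x = {e \<in> H. col (fst e) (snd e) = col x (g x)}" for x
      have "card (S x) \<le> card V" for x
      proof (rule card_inj_on_le[of fst])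
        show "inj_on fst (S x)"
        proof (rule inj_onI)
          fix d e assume de: "d \<in> S x" "e \<in> S x" "fst d = fst e"
          then have "snd d = snd e"
            using HV[of d] HV[of e] by (intro col_eqD[of "fst d" "snd d" "snd e"]) (auto simp: S_def)
          then show "d = e" using de(3) by (simp add: prod_eq_iff)
        qed
      qed (use HV finV in \<open>auto simp: S_def\<close>)
      then have "(\<Sum>x\<in>X. card (S x)) \<le> (\<Sum>x\<in>X. card V)" by (intro sum_mono)
      moreover have "N5 = (\<Union>x\<in>X. S x)" by (auto simp: N5_def S_def)
      ultimately show ?thesis using card_UN_le[OF finX, of S] X(2) by simp
    qed
    have "card (N1 \<union> N2 \<union> N3 \<union> N4 \<union> N5 \<union> Q) \<le> card N1 + card N2 + card N3 + card N4 + card N5 + card Q"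
      using card_Un_le[of "N1 \<union> N2 \<union> N3 \<union> N4 \<union> N5" Q] card_Un_le[of "N1 \<union> N2 \<union> N3 \<union> N4" N5]
        card_Un_le[of "N1 \<union> N2 \<union> N3" N4] card_Un_le[of "N1 \<union> N2" N3] card_Un_le[of N1 N2] by linarith
    also have "\<dots> < card H"
    proof -
      define \<rho> where "\<rho> = card (unpopular r) * b"
      have k8: "8 * (k * card V) \<le> 1001 * \<rho>"
      proof -
        have "(8 * k) * card V \<le> card (unpopular r) * (1001 * b)"
          using Suc.prems s8 cV by (intro mult_le_mono) linarith+
        then show ?thesis by (simp add: \<rho>_def mult_ac)
      qed
      have q: "4000 * card Q \<le> \<rho>"
      proof -
        have "1000 * (4 * card Q) \<le> 1000 * (m * card (unpopular r))" using Q by (intro mult_le_mono2)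
        also have "\<dots> \<le> b * card (unpopular r)" using m2 by (simp add: mult.assoc[symmetric])
        finally show ?thesis by (simp add: \<rho>_def mult_ac)
      qed
      have "0 < card (unpopular r)" using Suc.prems s8 by linarith
      then have "0 < \<rho>" using b3 by (simp add: \<rho>_def)
      moreover have "849 * \<rho> \<le> card H" using low by (simp add: \<rho>_def H_def mult_ac)
      moreover have "10 * card N2 \<le> \<rho>" using n2 by (simp add: \<rho>_def)
      moreover have "card N3 + card N4 + card N5 \<le> 5 * (k * card V)" using n3 n4 n5 by (simp add: mult.assoc)
      ultimately show ?thesis using n1 k8 q by linarith
    qed
    finally have "\<not> H \<subseteq> N1 \<union> N2 \<union> N3 \<union> N4 \<union> N5 \<union> Q"
      using card_mono[of "N1 \<union> N2 \<union> N3 \<union> N4 \<union> N5 \<union> Q" H] finH Q(1)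
      by (auto simp: N1_def N2_def N3_def N4_def N5_def)
    then obtain e where e: "e \<in> H" "e \<notin> N1" "e \<notin> N2" "e \<notin> N3" "e \<notin> N4" "e \<notin> N5" "e \<notin> Q" by blast
    obtain x j where xj: "e = (x, j)" by (cases e)
    have x: "x \<in> V" "j \<in> V" "x \<noteq> j" "x \<noteq> r" "x \<notin> T" "j \<notin> T" "x \<notin> U" "j \<notin> U" "popular (col r x)" "j \<in> outside r x" "(x, j) \<notin> Q"
      and xc: "\<And>y. y \<in> X \<Longrightarrow> col x j \<noteq> col y (g y)"
      using e HV[OF e(1)] xj by (auto simp: N1_def N2_def N3_def N4_def N5_def unpopular_def H_def free_pairs_def)
    have xX: "x \<notin> X" and jX: "j \<notin> g ` X" using x by (auto simp: U_def)
    define g' where "g' = g(x := j)"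
    have g'x: "g' x = j" and g': "\<And>y. y \<in> X \<Longrightarrow> g' y = g y" using xX by (auto simp: g'_def)
    have img: "g' ` insert x X = insert j (g ` X)" using g'x g' by auto
    note R = X(1)[unfolded reserved_def]
    have "reserved T r (insert x X) g'"
      unfolding reserved_def img
    proof (intro conjI)
      have "inj_on g' X" using R inj_on_cong[of X g' g] g' by simp
      then show "inj_on g' (insert x X)" using g'x g' jX xX by (auto simp: inj_on_insert)
      have "inj_on (\<lambda>x. col x (g' x)) X"
        using R by (subst inj_on_cong[of X _ "\<lambda>x. col x (g x)"]) (simp_all add: g')
      moreover have "col x j \<notin> (\<lambda>x. col x (g' x)) ` X" using xc g' by auto
      ultimately show "inj_on (\<lambda>x. col x (g' x)) (insert x X)" using g'x xX by (simp add: inj_on_insert)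
      show "insert x X \<inter> insert j (g ` X) = {}" using R x by (auto simp: U_def)
      show "\<forall>y\<in>insert x X. g' y \<in> outside r y \<and> popular (col r y)" using R x g'x g' by auto
    qed (use R x in auto)
    moreover have "card (insert x X) = Suc k" using xX finX X(2) by simp
    moreover have "\<forall>y\<in>insert x X. (y, g' y) \<notin> Q" using X(3) x g'x g' by auto
    ultimately show ?case by blast
  qed
  then show ?thesis by blast
qed

text \<open>Roots with fewer unpopular vertices are treated first. An earlier root s then occupies
  at most a quarter as many pairs as the present root has unpopular vertices, which is the bound on
  \<open>Q\<close> required by \<open>reserved_exists\<close>.\<close>

lemma reserved_family:
  assumes T: "sparse_roots T"
  shows "\<exists>X g. (\<forall>r\<in>T. reserved T r (X r) (g r) \<and>
       card (X r) = (if card (rich r) < 50 * b then card (unpopular r \<inter> T) else 0)) \<and>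
     (\<forall>r\<in>T. \<forall>r'\<in>T. r \<noteq> r' \<longrightarrow> arcs (X r) (g r) \<inter> arcs (X r') (g r') = {})"
proof -
  have finT: "finite T" and cT: "card T = m" using T finV by (auto simp: sparse_roots_def intro: finite_subset)
  define good where "good S X g \<longleftrightarrow> (\<forall>r\<in>S. reserved T r (X r) (g r) \<and>
       card (X r) = (if card (rich r) < 50 * b then card (unpopular r \<inter> T) else 0)) \<and>
     (\<forall>r\<in>S. \<forall>r'\<in>S. r \<noteq> r' \<longrightarrow> arcs (X r) (g r) \<inter> arcs (X r') (g r') = {})" for S X g
  have "S \<subseteq> T \<Longrightarrow> \<exists>X g. good S X g" if "finite S" for S
    using that
  proof (induction S rule: finite_ranking_induct[where f = "\<lambda>r. card (unpopular r)"])
    case empty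
    show ?case by (simp add: good_def)
  next
    case (insert r S)
    then obtain X g where Xg: "good S X g" by auto
    define Q where "Q = (\<Union>s\<in>S. arcs (X s) (g s))"
    have finXs: "finite (X s)" if "s \<in> S" for s
      using Xg that finV finite_subset[of "X s" V] unfolding good_def reserved_def by blast
    have finQ: "finite Q" using insert.hyps(1) finXs by (auto simp: Q_def arcs_def)
    have "\<exists>X' g'. reserved T r X' g' \<and> card X' = (if card (rich r) < 50 * b then card (unpopular r \<inter> T) else 0) \<and> (\<forall>x\<in>X'. (x, g' x) \<notin> Q)"
    proof (cases "card (rich r) < 50 * b")
      case True
      have each: "4 * card (arcs (X s) (g s)) \<le> card (unpopular r)" if s: "s \<in> S" for s
      proof -
        have "8 * card (X s) \<le> card (unpopular s)"
          using Xg s insert.prems T by (auto simp: good_def sparse_roots_def)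
        then show ?thesis
          using card_arcs_le[OF finXs[OF s], of "g s"] insert.hyps(2)[OF s] by linarith
      qed
      have "4 * card Q \<le> (\<Sum>s\<in>S. 4 * card (arcs (X s) (g s)))"
        unfolding Q_def using card_UN_le[OF insert.hyps(1), of "\<lambda>s. arcs (X s) (g s)"]
        by (simp flip: sum_distrib_left)
      also have "\<dots> \<le> (\<Sum>s\<in>S. card (unpopular r))" by (intro sum_mono each)
      also have "\<dots> \<le> m * card (unpopular r)"
        using insert.prems finT cT card_mono[of T S] by auto
      finally have "4 * card Q \<le> m * card (unpopular r)" .
      with reserved_exists[OF T _ True finQ] insert.prems True show ?thesis by auto
    next
      case False
      then show ?thesis by (intro exI[of _ "{}"]) (simp add: reserved_def)
    qed
    then obtain X' g' where X': "reserved T r X' g'"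
      "card X' = (if card (rich r) < 50 * b then card (unpopular r \<inter> T) else 0)" "\<forall>x\<in>X'. (x, g' x) \<notin> Q" by blast
    have dj: "arcs X' g' \<inter> arcs (X s) (g s) = {}" if "s \<in> S" for s
      using X'(3) that by (intro arcs_disjointI) (auto simp: Q_def)
    \<comment> \<open>The ranking induction also admits a root that is already in
      \<open>S\<close>.\<close>
    show ?case
    proof (cases "r \<in> S")
      case True
      then show ?thesis using Xg by (auto simp: insert_absorb)
    next
      case False
      have "good (insert r S) (X(r := X')) (g(r := g'))"
        unfolding good_def
      proof (intro conjI ballI impI)
        fix a c assume ac: "a \<in> insert r S" "c \<in> insert r S" "a \<noteq> c"
        then consider "a = r" "c \<in> S" | "a \<in> S" "c = r" | "a \<in> S" "c \<in> S" by auto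
        then show "arcs ((X(r := X')) a) ((g(r := g')) a) \<inter> arcs ((X(r := X')) c) ((g(r := g')) c) = {}"
        proof cases
          case 1 then show ?thesis using False dj[of c] by auto
        next
          case 2 then show ?thesis using False dj[of a] by auto
        next
          case 3 then show ?thesis using False Xg ac by (auto simp: good_def)
        qed
      qed (use False Xg X' in \<open>auto simp: good_def\<close>)
      then show ?thesis by blast
    qed
  qed
  then show ?thesis using finT unfolding good_def by blast
qed

end

section \<open>Edge-disjoint spiders\<close>

lemma arcs_unique:
  assumes "X \<inter> g ` X = {}" "inj_on g X" "(u, v) \<in> arcs X g" "(u, w) \<in> arcs X g"
  shows "v = w"
  using assms unfolding arcs_def by (auto dest: inj_onD)

lemma card_arc_nbrs_le:
  assumes "X \<inter> g ` X = {}" "inj_on g X"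
  shows "card {v \<in> V. (u, v) \<in> arcs X g} \<le> 1"
proof (cases "\<exists>w. (u, w) \<in> arcs X g")
  case True
  then obtain w where w: "(u, w) \<in> arcs X g" by blast
  have "{v \<in> V. (u, v) \<in> arcs X g} \<subseteq> {w}"
    using arcs_unique[OF assms w] by blast
  then have "card {v \<in> V. (u, v) \<in> arcs X g} \<le> card {w}" by (intro card_mono) auto
  then show ?thesis by simp
next
  case False
  then show ?thesis by simp
qed

context big_clique begin

text \<open>The condition \<open>X \<inter> T = F\<close> is an equality because an edge between two
  roots belongs to the star of the earlier one: each spider detaches the earlier roots from its
  centre and keeps the later ones.\<close>

definition legs :: "'a set \<Rightarrow> 'a \<Rightarrow> 'a set \<Rightarrow> nat \<Rightarrow> 'a set \<Rightarrow> ('a \<Rightarrow> 'a) \<Rightarrow> bool" where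
  "legs T r F t X g \<longleftrightarrow> X \<subseteq> V - {r} \<and> X \<inter> T = F \<and> card X = t \<and> g ` X \<subseteq> V \<and> g ` X \<inter> (X \<union> T) = {} \<and> inj_on g X \<and>
     inj_on (\<lambda>x. col x (g x)) X \<and> (\<forall>x\<in>X. \<forall>v\<in>V - {r} - X. col x (g x) \<noteq> col r v)"

text \<open>At most one leg has the colour \<open>q\<close>, and it has two ends.\<close>

lemma card_arc_col_le:
  assumes "finite X" "inj_on (\<lambda>x. col x (g x)) X"
  shows "card {z. \<exists>v. (z, v) \<in> arcs X g \<and> col z v = q} \<le> 2"
proof -
  define x0 where "x0 = (THE x. x \<in> X \<and> col x (g x) = q)"
  have x0: "x = x0" if "x \<in> X" "col x (g x) = q" for x
    unfolding x0_def using that assms(2) by (intro the_equality[symmetric]) (auto dest: inj_onD)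
  have "{z. \<exists>v. (z, v) \<in> arcs X g \<and> col z v = q} \<subseteq> {x0, g x0}"
    using x0 by (auto simp: arcs_def col_sym[of "g _"])
  then have "card {z. \<exists>v. (z, v) \<in> arcs X g \<and> col z v = q} \<le> card {x0, g x0}" by (intro card_mono) auto
  also have "\<dots> \<le> 2" by (simp add: card_insert_if)
  finally show ?thesis .
qed

text \<open>The set \<open>A f\<close> will be the set of vertices which the spider rooted at \<open>f\<close> does not join
  to its root, so that no edge from \<open>f\<close> to \<open>A f\<close> lies in the star of \<open>f\<close>.\<close>

lemma legs_exist:
  assumes T: "sparse_roots T" and r: "r \<in> T" and F: "F \<subseteq> T - {r}"
    and A: "\<And>f. f \<in> F \<Longrightarrow> A f \<subseteq> V - {f}" "\<And>f. f \<in> F \<Longrightarrow> card (A f) = t"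
    and t: "700 * m \<le> t" "5 * t \<le> card V"
    and Q: "finite I" "card I \<le> m" "\<And>i. i \<in> I \<Longrightarrow> finite (Y i) \<and> Y i \<inter> h i ` Y i = {} \<and> inj_on (h i) (Y i) \<and>
        inj_on (\<lambda>x. col x (h i x)) (Y i)"
    and XO: "reserved T r XO gO" "card XO = (if card (rich r) < 50 * b then card (unpopular r \<inter> T) else 0)"
      "\<And>i. i \<in> I \<Longrightarrow> arcs XO gO \<inter> arcs (Y i) (h i) = {}"
  shows "\<exists>X g. legs T r F t X g \<and> (\<forall>f\<in>F. g f \<in> A f) \<and> (\<forall>i\<in>I. arcs X g \<inter> arcs (Y i) (h i) = {})"
proof -
  define E where "E u v \<longleftrightarrow> (\<exists>i\<in>I. (u, v) \<in> arcs (Y i) (h i))" for u v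
  have TV: "T \<subseteq> V" and cT: "card T = m" using T by (auto simp: sparse_roots_def)
  have finT: "finite T" using TV finV finite_subset by blast
  have rV: "r \<in> V" using r TV by auto
  interpret spider_step V col b m r T F A E
  proof
    show "r \<in> T" "T \<subseteq> V" "card T \<le> m" "F \<subseteq> T - {r}" using r TV cT F by auto
    show "A f \<subseteq> V - {f}" "700 * m \<le> card (A f)" if "f \<in> F" for f using A that t by auto
    show "card {v \<in> V. E u v} \<le> m" if "u \<in> V" for u
    proof -
      have "card {v \<in> V. E u v} = card (\<Union>i\<in>I. {v \<in> V. (u, v) \<in> arcs (Y i) (h i)})"
        by (rule arg_cong[where f = card]) (auto simp: E_def)
      also have "\<dots> \<le> (\<Sum>i\<in>I. card {v \<in> V. (u, v) \<in> arcs (Y i) (h i)})" by (rule card_UN_le[OF Q(1)])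
      also have "\<dots> \<le> (\<Sum>i\<in>I. 1)"
        using Q(3) by (intro sum_mono card_arc_nbrs_le) auto
      finally show ?thesis using Q(2) by simp
    qed
    show "card {z \<in> V. \<exists>v\<in>V. E z v \<and> col z v = q} \<le> 2 * m" for q
    proof -
      let ?S = "\<lambda>i. {z. \<exists>v. (z, v) \<in> arcs (Y i) (h i) \<and> col z v = q}"
      have finS: "finite (?S i)" if i: "i \<in> I" for i
      proof -
        have "finite (arcs (Y i) (h i))" using Q(3)[OF i] by (auto simp: arcs_def)
        then show ?thesis by (rule finite_surj[where f = fst]) force
      qed
      have "card {z \<in> V. \<exists>v\<in>V. E z v \<and> col z v = q} \<le> card (\<Union>i\<in>I. ?S i)"
        using finS Q(1) by (intro card_mono) (auto simp: E_def)
      also have "\<dots> \<le> (\<Sum>i\<in>I. card (?S i))" by (rule card_UN_le[OF Q(1)])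
      also have "\<dots> \<le> (\<Sum>i\<in>I. 2)" using Q(3) by (intro sum_mono card_arc_col_le) auto
      finally show ?thesis using Q(2) by simp
    qed
  qed
  note R = XO(1)[unfolded reserved_def]
  have "XO \<subseteq> V" using R by blast
  then have finXO: "finite XO" using finV by (rule finite_subset)
  have XOout: "col x (gO x) \<notin> star_cols r" if "x \<in> XO" for x
    using R that by (auto simp: outside_def)
  have st0: "partial_spider XO gO F"
    unfolding partial_spider_def
  proof (intro conjI ballI)
    fix x assume x: "x \<in> XO"
    have "(x, gO x) \<in> arcs XO gO" using x by (auto simp: arcs_def)
    then show "\<not> E x (gO x)" using XO(3) by (auto simp: E_def)
    show "col x (gO x) \<noteq> col r v" if "v \<in> V - {r} - XO - F" for v
      using XOout[OF x] that by (auto simp: star_cols_def)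
  next
    show "gO ` XO \<inter> (XO \<union> F \<union> T) = {}" using R F by auto
  qed (use R F TV r in auto)
  have cXO: "card XO \<le> m"
    using XO(2) cT card_mono[OF finT, of "unpopular r \<inter> T"] by auto
  \<comment> \<open>Each root in \<open>F\<close> needs a freed popular colour of its own: that of
    its edge to \<open>r\<close> if it is popular, and otherwise that of a reserved vertex. The two
    kinds do not collide, as reserved vertices lie outside \<open>T\<close>.\<close>
  have "\<exists>uu. 50 * b \<le> card (rich r) \<or>
     inj_on uu F \<and> (\<forall>f\<in>F. popular (col r (uu f)) \<and> uu f \<in> XO \<union> F \<and> col r (uu f) \<notin> cols XO gO)"
  proof (cases "card (rich r) < 50 * b")
    case True
    then obtain \<beta> where \<beta>: "bij_betw \<beta> (unpopular r \<inter> T) XO"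
      using XO(2) finT finXO finite_same_card_bij[of "unpopular r \<inter> T" XO] by auto
    define uu where "uu f = (if f \<in> unpopular r then \<beta> f else f)" for f
    have \<beta>X: "\<beta> f \<in> XO" if "f \<in> F" "f \<in> unpopular r" for f
      using \<beta> that F by (auto simp: bij_betw_def)
    have XT: "XO \<inter> T = {}" using R by auto
    have "inj_on uu F"
    proof (rule inj_onI)
      fix f f' assume f: "f \<in> F" "f' \<in> F" "uu f = uu f'"
      have fT: "f \<in> T" "f' \<in> T" using f F by auto
      consider "f \<in> unpopular r" "f' \<in> unpopular r" | "f \<in> unpopular r" "f' \<notin> unpopular r" | "f \<notin> unpopular r" "f' \<in> unpopular r"
        | "f \<notin> unpopular r" "f' \<notin> unpopular r" by blast
      then show "f = f'"
      proof cases
        case 1 then show ?thesis using f fT \<beta> by (auto simp: uu_def bij_betw_def dest: inj_onD)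
      next
        case 2 then show ?thesis using f fT XT \<beta>X[of f] by (auto simp: uu_def)
      next
        case 3 then show ?thesis using f fT XT \<beta>X[of f'] by (auto simp: uu_def)
      next
        case 4 then show ?thesis using f by (simp add: uu_def)
      qed
    qed
    moreover have "popular (col r (uu f)) \<and> uu f \<in> XO \<union> F \<and> col r (uu f) \<notin> cols XO gO" if f: "f \<in> F" for f
    proof (intro conjI)
      have fV: "f \<in> V - {r}" using f F TV by auto
      show "popular (col r (uu f))" using \<beta>X[OF f] R fV by (auto simp: uu_def unpopular_def)
      show u: "uu f \<in> XO \<union> F" using \<beta>X[OF f] f by (auto simp: uu_def)
      then have "uu f \<in> V - {r}" using R F TV r by auto
      then have "col r (uu f) \<in> star_cols r" by (auto simp: star_cols_def)
      then show "col r (uu f) \<notin> cols XO gO" using XOout by (auto simp: cols_def)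
    qed
    ultimately show ?thesis by blast
  next
    case False
    then show ?thesis by auto
  qed
  then obtain uu where uu: "50 * b \<le> card (rich r) \<or>
     inj_on uu F \<and> (\<forall>f\<in>F. popular (col r (uu f)) \<and> uu f \<in> XO \<union> F \<and> col r (uu f) \<notin> cols XO gO)" by blast
  obtain X g where X: "partial_spider X g {}" "F \<subseteq> X" "card X = t"
    using spider_exists[OF st0 cXO uu t] by blast
  note s = partial_spiderD[OF X(1)]
  have "legs T r F t X g"
    unfolding legs_def using s X F by auto
  moreover have "\<forall>f\<in>F. g f \<in> A f" using s(11) X(2) by auto
  moreover have "arcs X g \<inter> arcs (Y i) (h i) = {}" if "i \<in> I" for i
    using s(9) that by (intro arcs_disjointI) (auto simp: E_def)
  ultimately show ?thesis by blast
qed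

text \<open>Legs that start at an earlier root r_j need extra care, as they could lie in the star of
  r_j; they do not, because their other end belongs to \<open>X j\<close>. No other leg of a later
  spider contains r_j.\<close>

lemma legs_family:
  assumes t: "700 * m \<le> t" "5 * t \<le> card V"
  shows "\<exists>T root X g. T \<subseteq> V \<and> bij_betw root {..<m} T \<and>
     (\<forall>i<m. legs T (root i) (root ` {..<i}) t (X i) (g i)) \<and>
     (\<forall>i<m. \<forall>j<i. g i (root j) \<in> X j \<and> arcs (X i) (g i) \<inter> arcs (X j) (g j) = {})"
proof -
  obtain T where T: "sparse_roots T" using sparse_roots_exist by blast
  have TV: "T \<subseteq> V" and cT: "card T = m" using T by (auto simp: sparse_roots_def)
  have finT: "finite T" using TV finV finite_subset by blast
  obtain XO gO where O: "\<And>r. r \<in> T \<Longrightarrow> reserved T r (XO r) (gO r) \<and>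
       card (XO r) = (if card (rich r) < 50 * b then card (unpopular r \<inter> T) else 0)"
     and Odisj: "\<And>r r'. r \<in> T \<Longrightarrow> r' \<in> T \<Longrightarrow> r \<noteq> r' \<Longrightarrow> arcs (XO r) (gO r) \<inter> arcs (XO r') (gO r') = {}"
    using reserved_family[OF T] by blast
  obtain root where root: "bij_betw root {..<m} T"
    using ex_bij_betw_nat_finite[OF finT] cT by (auto simp: atLeast0LessThan)
  have rootT: "root i \<in> T" if "i < m" for i using root that by (auto simp: bij_betw_def)
  have rinj: "root i \<noteq> root j" if "i < m" "j < m" "i \<noteq> j" for i j
    using root that by (auto simp: bij_betw_def dest: inj_onD)
  \<comment> \<open>The last clause keeps the edges reserved for the spiders still to come untouched
    by those already built.\<close>
  define good where "good k X g \<longleftrightarrow> (\<forall>i<k. legs T (root i) (root ` {..<i}) t (X i) (g i)) \<and>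
     (\<forall>i<k. \<forall>j<i. g i (root j) \<in> X j \<and> arcs (X i) (g i) \<inter> arcs (X j) (g j) = {}) \<and>
     (\<forall>i<k. \<forall>j<m. i < j \<longrightarrow> arcs (X i) (g i) \<inter> arcs (XO (root j)) (gO (root j)) = {})"
    for k and X :: "nat \<Rightarrow> 'a set" and g
  have "k \<le> m \<Longrightarrow> \<exists>X g. good k X g" for k
  proof (induction k)
    case 0
    show ?case by (simp add: good_def)
  next
    case (Suc k)
    then obtain X g where G: "good k X g" by auto
    have km: "k < m" using Suc.prems by simp
    define F where "F = root ` {..<k}"
    define A where "A f = X (the_inv_into {..<m} root f)" for f
    have Aroot: "A (root i) = X i" if "i < m" for i
      using root that by (simp add: A_def the_inv_into_f_f bij_betw_def)
    define Y where "Y i = (if i < k then X i else XO (root i))" for i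
    define h where "h i = (if i < k then g i else gO (root i))" for i
    define I where "I = {..<m} - {k}"
    have "\<exists>X' g'. legs T (root k) F t X' g' \<and> (\<forall>f\<in>F. g' f \<in> A f) \<and> (\<forall>i\<in>I. arcs X' g' \<inter> arcs (Y i) (h i) = {})"
    proof (rule legs_exist[OF T rootT[OF km] _ _ _ t, where XO = "XO (root k)" and gO = "gO (root k)"])
      show "F \<subseteq> T - {root k}" using rootT rinj km by (auto simp: F_def)
      show "A f \<subseteq> V - {f}" "card (A f) = t" if fF: "f \<in> F" for f
      proof -
        obtain i where i: "i < k" "f = root i" using fF by (auto simp: F_def)
        have "legs T (root i) (root ` {..<i}) t (X i) (g i)" using G i by (simp add: good_def)
        then show "A f \<subseteq> V - {f}" "card (A f) = t" using Aroot[of i] i km by (auto simp: legs_def)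
      qed
      show "finite I" "card I \<le> m" using km by (simp_all add: I_def)
      show "finite (Y i) \<and> Y i \<inter> h i ` Y i = {} \<and> inj_on (h i) (Y i) \<and> inj_on (\<lambda>x. col x (h i x)) (Y i)"
        if "i \<in> I" for i
      proof (cases "i < k")
        case True
        then have "legs T (root i) (root ` {..<i}) t (X i) (g i)" using G by (simp add: good_def)
        then show ?thesis using True finV finite_subset[of "X i" V] by (auto simp: Y_def h_def legs_def)
      next
        case False
        then have "reserved T (root i) (XO (root i)) (gO (root i))" using O rootT that by (simp add: I_def)
        then show ?thesis using False finV finite_subset[of "XO (root i)" V] by (auto simp: Y_def h_def reserved_def)
      qed
      show "reserved T (root k) (XO (root k)) (gO (root k))"
        "card (XO (root k)) = (if card (rich (root k)) < 50 * b then card (unpopular (root k) \<inter> T) else 0)"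
        using O[OF rootT[OF km]] by simp_all
      show "arcs (XO (root k)) (gO (root k)) \<inter> arcs (Y i) (h i) = {}" if "i \<in> I" for i
      proof (cases "i < k")
        case True
        then show ?thesis using G km by (simp add: good_def Y_def h_def Int_commute)
      next
        case False
        then show ?thesis using that Odisj[of "root k" "root i"] rootT rinj km by (simp add: I_def Y_def h_def)
      qed
    qed
    then obtain X' g' where X': "legs T (root k) F t X' g'" "\<forall>f\<in>F. g' f \<in> A f" "\<forall>i\<in>I. arcs X' g' \<inter> arcs (Y i) (h i) = {}" by blast
    have c: "g' (root j) \<in> X j" "arcs X' g' \<inter> arcs (X j) (g j) = {}" if "j < k" for j
      using bspec[OF X'(2), of "root j"] bspec[OF X'(3), of j] that km Aroot[of j]
      by (simp_all add: F_def I_def Y_def h_def)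
    have d: "arcs X' g' \<inter> arcs (XO (root j)) (gO (root j)) = {}" if "k < j" "j < m" for j
      using bspec[OF X'(3), of j] that by (simp add: I_def Y_def h_def)
    have "good (Suc k) (X(k := X')) (g(k := g'))"
      unfolding good_def
    proof (intro conjI allI impI)
      fix i assume i: "i < Suc k"
      show "legs T (root i) (root ` {..<i}) t ((X(k := X')) i) ((g(k := g')) i)"
        using i G X'(1) by (cases "i = k") (simp_all add: good_def F_def)
      { fix j assume j: "j < i"
        show "(g(k := g')) i (root j) \<in> (X(k := X')) j"
          using i j G c(1)[of j] by (cases "i = k") (simp_all add: good_def)
        show "arcs ((X(k := X')) i) ((g(k := g')) i) \<inter> arcs ((X(k := X')) j) ((g(k := g')) j) = {}"
          using i j G c(2)[of j] by (cases "i = k") (simp_all add: good_def) }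
      fix j assume j: "j < m" "i < j"
      show "arcs ((X(k := X')) i) ((g(k := g')) i) \<inter> arcs (XO (root j)) (gO (root j)) = {}"
        using i j G d[of j] by (cases "i = k") (simp_all add: good_def)
    qed
    then show ?case by blast
  qed
  then obtain X g where "good m X g" by blast
  then show ?thesis
    using TV root by (intro exI[of _ T] exI[of _ root] exI[of _ X] exI[of _ g]) (simp add: good_def)
qed

end

section \<open>From legs to spider graphs\<close>

locale coloured_complete_graph =
  fixes V :: "'a set" and c :: "'a set \<Rightarrow> 'c"
  assumes finite_V: "finite V" and proper_c: "proper_edge_colouring (complete_graph V) c"
begin

sublocale coloured_clique V "\<lambda>u v. c {u, v}"
proof
  show "finite V" by (rule finite_V)
  show "c {u, v} = c {v, u}" for u v by (simp add: insert_commute)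
  fix u v w assume a: "u \<in> V" "v \<in> V" "w \<in> V" "v \<noteq> u" "w \<noteq> u" "v \<noteq> w"
  then have "{u, v} \<in> nsets V 2" "{u, w} \<in> nsets V 2" by (auto simp: nsets_def card_insert_if)
  moreover have "{u, v} \<noteq> {u, w}" using a by (auto simp: doubleton_eq_iff)
  ultimately show "c {u, v} \<noteq> c {u, w}"
    using proper_c by (auto simp: proper_edge_colouring_def complete_graph_def)
qed

text \<open>For x in \<open>X\<close> the vertex \<open>g x\<close> is the middle of the leg and x
  its end. Since \<open>g x\<close> lies outside \<open>X\<close>, the star part already joins it to
  \<open>r\<close>.\<close>

definition spider_of :: "'a \<Rightarrow> 'a set \<Rightarrow> ('a \<Rightarrow> 'a) \<Rightarrow> 'a graph" where
  "spider_of r X g = (V, (\<lambda>v. {r, v}) ` (V - {r} - X) \<union> (\<lambda>x. {x, g x}) ` X)"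

lemma spider_of:
  assumes r: "r \<in> V" "r \<notin> g ` X" and X: "X \<subseteq> V - {r}" "card X = t" "g ` X \<subseteq> V" "g ` X \<inter> X = {}" "inj_on g X"
  shows "spanning_subgraph (spider_of r X g) (complete_graph V)" "spider t (spider_of r X g)"
proof -
  have gx: "x \<in> V" "g x \<in> V" "g x \<noteq> x" "x \<noteq> g x" if "x \<in> X" for x using X that by auto
  have "edges (spider_of r X g) \<subseteq> nsets V 2"
    using r gx by (auto simp: spider_of_def nsets_def card_insert_if)
  then show "spanning_subgraph (spider_of r X g) (complete_graph V)"
    by (auto simp: spanning_subgraph_def subgraph_def is_graph_def complete_graph_def spider_of_def finite_V)
  have finX: "finite X" using X finite_V finite_subset by blast
  obtain xs where xs: "set xs = X" "distinct xs" using finite_distinct_list[OF finX] by blast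
  obtain ys where ys: "set ys = V - {r} - X - g ` X" "distinct ys"
    using finite_distinct_list[of "V - {r} - X - g ` X"] finite_V by auto
  have len: "length xs = t" using xs X(2) distinct_card by force
  have legs: "(\<lambda>x. {x, g x}) ` X = {{map g xs ! i, xs ! i} | i. i < t}"
    unfolding xs(1)[symmetric] len[symmetric] by (auto simp: set_conv_nth insert_commute image_iff)
  show "spider t (spider_of r X g)"
    unfolding spider_def
  proof (intro exI conjI)
    show "length (map g xs) = t" "length xs = t" using len by simp_all
    show "distinct (r # map g xs @ xs @ ys)"
      using xs ys X r by (auto simp: distinct_map)
    show "vertices (spider_of r X g) = set (r # map g xs @ xs @ ys)"
      using xs ys X r by (auto simp: spider_of_def)
    have "V - {r} - X = g ` X \<union> set ys" using ys X r by auto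
    then show "edges (spider_of r X g) = {{r, j} |j. j \<in> set (map g xs)} \<union> {{r, y} |y. y \<in> set ys} \<union>
        {{map g xs ! i, xs ! i} |i. i < t}"
      unfolding legs[symmetric] using xs(1) by (auto simp: spider_of_def)
  qed
qed

lemma rainbow_spider_of:
  assumes r: "r \<in> V" and inj: "inj_on (\<lambda>x. c {x, g x}) X"
    and free: "\<And>x v. x \<in> X \<Longrightarrow> v \<in> V - {r} - X \<Longrightarrow> c {x, g x} \<noteq> c {r, v}"
  shows "rainbow c (spider_of r X g)"
proof -
  have "inj_on c ((\<lambda>v. {r, v}) ` (V - {r} - X))"
  proof (rule inj_onI)
    fix e f assume e: "e \<in> (\<lambda>v. {r, v}) ` (V - {r} - X)" "f \<in> (\<lambda>v. {r, v}) ` (V - {r} - X)" "c e = c f"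
    then obtain v w where "e = {r, v}" "f = {r, w}" "v \<in> V - {r}" "w \<in> V - {r}" by blast
    then show "e = f" using inj_onD[OF inj_col[OF r], of v w] e(3) by auto
  qed
  moreover have "inj_on c ((\<lambda>x. {x, g x}) ` X)"
    using inj by (intro inj_on_imageI) (simp add: comp_def)
  moreover have "c ` ((\<lambda>v. {r, v}) ` (V - {r} - X)) \<inter> c ` ((\<lambda>x. {x, g x}) ` X) = {}"
    using free by fastforce
  ultimately show ?thesis
    unfolding rainbow_def spider_of_def snd_conv inj_on_Un by blast
qed

end

theorem theorem4:
  fixes n t :: nat and V :: "'a set" and c :: "'a set \<Rightarrow> 'c"
  assumes "n > 0"
    and "finite V" and "card V = n"
    and "proper_edge_colouring (complete_graph V) c"
    and "0.0007 * real n \<le> real t" and "real t \<le> 0.2 * real n"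
  shows "\<exists>S :: nat \<Rightarrow> 'a graph.
           (\<forall>i < nat \<lfloor>real n / 10 ^ 6\<rfloor>.
              spanning_subgraph (S i) (complete_graph V) \<and> spider t (S i) \<and> rainbow c (S i)) \<and>
           disjoint_family_on (\<lambda>i. edges (S i)) {..<nat \<lfloor>real n / 10 ^ 6\<rfloor>}"
proof -
  define m where "m = n div 10 ^ 6"
  have m: "nat \<lfloor>real n / 10 ^ 6\<rfloor> = m"
    using floor_divide_of_nat_eq[of n "10 ^ 6", where 'a = real] by (simp add: m_def)
  show ?thesis
  proof (cases "m = 0")
    case True
    then show ?thesis unfolding m by (simp add: disjoint_family_on_def)
  next
    case False
    \<comment> \<open>Since m > 0, n is at least 10^6 and b at least 1000, so rounding costs at most
      a factor 1001/1000. The 700 in \<open>700 * m \<le> t\<close> is 0.0007 * 10^6.\<close>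
    define b where "b = n div 1000"
    have mn: "1000000 * m \<le> n" by (simp add: m_def)
    interpret coloured_complete_graph V c
      using assms by unfold_locales
    interpret big_clique V "\<lambda>u v. c {u, v}" b m
    proof
      show "1000 * b \<le> card V" using assms(3) by (simp add: b_def)
      show b: "1000 \<le> b" using mn False by (simp add: b_def less_eq_div_iff_mult_less_eq)
      have "n < 1000 * b + 1000" using dividend_less_div_times[of 1000 n] by (simp add: b_def)
      then show "card V \<le> 1001 * b" using b assms(3) by linarith
      show "1 \<le> m" using False by simp
      show "1000 * m \<le> b" using mn by (simp add: b_def less_eq_div_iff_mult_less_eq)
    qed
    have "7 * real n \<le> 10000 * real t" "5 * real t \<le> real n" using assms(5,6) by simp_all
    then have t1: "7 * n \<le> 10000 * t" "5 * t \<le> n" by linarith+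
    have t: "700 * m \<le> t" "5 * t \<le> card V" using t1 mn assms(3) by linarith+
    obtain T root X g where T: "T \<subseteq> V" "bij_betw root {..<m} T"
      and L: "\<forall>i<m. legs T (root i) (root ` {..<i}) t (X i) (g i)"
      and D: "\<forall>i<m. \<forall>j<i. g i (root j) \<in> X j \<and> arcs (X i) (g i) \<inter> arcs (X j) (g j) = {}"
      using legs_family[OF t] by (elim exE conjE) (rule that)
    have rootT: "root i \<in> T" if "i < m" for i using T that by (auto simp: bij_betw_def)
    have rinj: "i = j" if "i < m" "j < m" "root i = root j" for i j
      using T that by (auto simp: bij_betw_def dest: inj_onD)
    define S where "S i = spider_of (root i) (X i) (g i)" for i
    have "spanning_subgraph (S i) (complete_graph V) \<and> spider t (S i) \<and> rainbow c (S i)" if i: "i < m" for i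
    proof (intro conjI)
      note l = L[rule_format, OF i, unfolded legs_def]
      have rV: "root i \<in> V" "root i \<notin> g i ` X i" using rootT[OF i] T(1) l by auto
      show "spanning_subgraph (S i) (complete_graph V)" "spider t (S i)"
        unfolding S_def using l by (intro spider_of[OF rV]; auto)+
      show "rainbow c (S i)" unfolding S_def using l by (intro rainbow_spider_of[OF rV(1)]) auto
    qed
    moreover have lt: "edges (S i) \<inter> edges (S j) = {}" if ij: "i < m" "j < i" for i j
    proof -
      have jm: "j < m" using ij by simp
      note li = L[rule_format, OF ij(1), unfolded legs_def] and lj = L[rule_format, OF jm, unfolded legs_def]
        and d = D[rule_format, OF ij]
      have ri: "root i \<in> T" "root j \<in> T" "root i \<noteq> root j"
        using rootT[OF ij(1)] rootT[OF jm] rinj[OF ij(1) jm] ij(2) by auto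
      have rj: "root j \<in> X i" using li ij by auto
      have riX: "root i \<notin> X j"
      proof
        assume "root i \<in> X j"
        then have "root i \<in> root ` {..<j}" using lj ri by auto
        then obtain l where "l < j" "root i = root l" by auto
        then show False using rinj[OF ij(1), of l] ij by simp
      qed
      have notg: "root i \<notin> g j ` X j" "root j \<notin> g i ` X i" using li lj ri by auto
      have arc: "(x, g i x) \<notin> arcs (X j) (g j)" if "x \<in> X i" for x
        using d that by (auto simp: arcs_def)
      \<comment> \<open>Only the edge between the two centres could lie in both stars, and spider
        \<open>i\<close> has detached \<open>root j\<close>.\<close>
      have 1: "{root i, v} \<noteq> {root j, w}" if "v \<in> V - {root i} - X i" for v w
        using that rj ri by (auto simp: doubleton_eq_iff)
      have 2: "{root i, v} \<noteq> {x, g j x}" if "x \<in> X j" for v x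
        using that riX notg by (auto simp: doubleton_eq_iff)
      \<comment> \<open>A leg of spider \<open>i\<close> that contains \<open>root j\<close> has its
        other end in \<open>X j\<close>, outside the star of \<open>root j\<close>.\<close>
      have 3: "{root j, v} \<noteq> {x, g i x}" if "x \<in> X i" "v \<in> V - {root j} - X j" for v x
        using that d notg by (auto simp: doubleton_eq_iff)
      have 4: "{x, g i x} \<noteq> {y, g j y}" if "x \<in> X i" "y \<in> X j" for x y
        using arc[OF that(1)] that(2) by (auto simp: doubleton_eq_iff arcs_def)
      have "e \<notin> edges (S j)" if "e \<in> edges (S i)" for e
        using that unfolding S_def spider_of_def snd_conv
      proof
        assume "e \<in> (\<lambda>v. {root i, v}) ` (V - {root i} - X i)"
        then obtain v where "v \<in> V - {root i} - X i" "e = {root i, v}" by blast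
        then show "e \<notin> (\<lambda>v. {root j, v}) ` (V - {root j} - X j) \<union> (\<lambda>x. {x, g j x}) ` X j"
          using 1[of v] 2[of _ v] by auto
      next
        assume "e \<in> (\<lambda>x. {x, g i x}) ` X i"
        then obtain x where "x \<in> X i" "e = {x, g i x}" by blast
        then show "e \<notin> (\<lambda>v. {root j, v}) ` (V - {root j} - X j) \<union> (\<lambda>x. {x, g j x}) ` X j"
          using 3[of x] 4[of x] by auto
      qed
      then show ?thesis by blast
    qed
    have "disjoint_family_on (\<lambda>i. edges (S i)) {..<m}"
      unfolding disjoint_family_on_def
    proof (intro ballI impI)
      fix i j assume "i \<in> {..<m}" "j \<in> {..<m}" "i \<noteq> j"
      then show "edges (S i) \<inter> edges (S j) = {}"
        using lt[of i j] lt[of j i] by (cases i j rule: linorder_cases) (auto simp: Int_commute)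
    qed
    ultimately show ?thesis unfolding m by blast
  qed
qed

end
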